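(* Every $\Delta(1,2,2)$-free tournament is $3$-colourable, and a $\Delta(1,2,2)$-free tournament is $2$-colourable if and only if it is $P_7$-free.
   Context: Tournaments are finite; $T$ is $S$-free if no induced subtournament of $T$ is isomorphic to $S$. $\Delta(1,2,2)$ is the tournament on $\{x,y_1,y_2,z_1,z_2\}$ in which every edge between $x$ and $\{y_1,y_2\}$ goes from $x$, every edge between $\{y_1,y_2\}$ and $\{z_1,z_2\}$ goes into $\{z_1,z_2\}$, every edge between $\{z_1,z_2\}$ and $x$ goes into $x$, and $y_1y_2$, $z_1z_2$ are edges. $P_7$ is the tournament on $v_1,\dots,v_7$ with $v_iv_j$ an edge iff $j-i\equiv1,2,4\pmod 7$. For an integer $k\ge1$, a $k$-colouring of a tournament $T$ is a map $f:V(T)\to\{1,\dots,k\}$ such that each colour class $\{v:f(v)=i\}$ induces a transitive subtournament; $T$ is $k$-colourable if it admits one. *)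

theory Defs
  imports "Graph_Theory.Pair_Digraph" "Graph_Theory.Digraph_Isomorphism"
begin

locale tournament = pair_digraph T for T :: "'a pair_pre_digraph" +
  assumes exactly_one_arc: "\<lbrakk>u \<in> pverts T; v \<in> pverts T; u \<noteq> v\<rbrakk>
    \<Longrightarrow> (u, v) \<in> parcs T \<longleftrightarrow> (v, u) \<notin> parcs T"

definition tournament_free :: "'b pair_pre_digraph \<Rightarrow> 'a pair_pre_digraph \<Rightarrow> bool" where
  "tournament_free S T \<longleftrightarrow>
    \<not> (\<exists>W \<subseteq> pverts T. digraph_iso (with_proj T \<restriction> W) (with_proj S))"

definition colouring :: "'a pair_pre_digraph \<Rightarrow> nat \<Rightarrow> ('a \<Rightarrow> nat) \<Rightarrow> bool" where
  "colouring T k f \<longleftrightarrow> f ` pverts T \<subseteq> {1..k} \<and>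
    (\<forall>i \<in> {1..k}. trans (arcs_ends (with_proj T \<restriction> {v \<in> pverts T. f v = i})))"

definition colourable :: "nat \<Rightarrow> 'a pair_pre_digraph \<Rightarrow> bool" where
  "colourable k T \<longleftrightarrow> (\<exists>f. colouring T k f)"

text \<open>The vertices \<open>x, y\<^sub>1, y\<^sub>2, z\<^sub>1, z\<^sub>2\<close> of \<open>\<Delta>(1,2,2)\<close> are encoded as \<open>0, 1, 2, 3, 4\<close>.\<close>

definition Delta122 :: "nat pair_pre_digraph" where
  "Delta122 = \<lparr> pverts = {0, 1, 2, 3, 4},
    parcs = {0} \<times> {1, 2} \<union> {1, 2} \<times> {3, 4} \<union> {3, 4} \<times> {0} \<union> {(1, 2), (3, 4)} \<rparr>"

definition P7 :: "int pair_pre_digraph" where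
  "P7 = \<lparr> pverts = {1..7},
    parcs = {(i, j). i \<in> {1..7} \<and> j \<in> {1..7} \<and> (j - i) mod 7 \<in> {1, 2, 4}} \<rparr>"

lemma tournamentI:
  assumes fin: "finite (pverts T)"
    and sub: "parcs T \<subseteq> pverts T \<times> pverts T"
    and irr: "\<forall>u \<in> pverts T. (u, u) \<notin> parcs T"
    and one: "\<forall>u \<in> pverts T. \<forall>v \<in> pverts T. u \<noteq> v \<longrightarrow>
      (u, v) \<in> parcs T \<longleftrightarrow> (v, u) \<notin> parcs T"
  shows "tournament T"
proof unfold_locales
  show "fst e \<in> pverts T" "snd e \<in> pverts T" if "e \<in> parcs T" for e
    using that sub by auto
  show "finite (pverts T)" by (rule fin)
  show "finite (parcs T)" using finite_subset[OF sub] fin by blast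
  show "fst e \<noteq> snd e" if "e \<in> parcs T" for e
    using that sub irr by (cases e) auto
  show "(u, v) \<in> parcs T \<longleftrightarrow> (v, u) \<notin> parcs T"
    if "u \<in> pverts T" "v \<in> pverts T" "u \<noteq> v" for u v
    using that one by blast
qed

lemma tournament_Delta122: "tournament Delta122"
  by (rule tournamentI) (simp_all add: Delta122_def)

lemma tournament_P7: "tournament P7"
proof -
  have "{1..7} = {1, 2, 3, 4, 5, 6, 7::int}" by auto
  then have one: "\<forall>i \<in> {1..7::int}. \<forall>j \<in> {1..7}. i \<noteq> j \<longrightarrow>
      (j - i) mod 7 \<in> {1, 2, 4} \<longleftrightarrow> (i - j) mod 7 \<notin> {1, 2, 4}"
    by simp
  show ?thesis
  proof (rule tournamentI)
    show "parcs P7 \<subseteq> pverts P7 \<times> pverts P7"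
      unfolding P7_def by auto
  qed (use one in \<open>simp_all add: P7_def\<close>)
qed

end

theory Submission
  imports Defs
begin

text \<open>
  A smallest \<open>\<Delta>(1,2,2)\<close>-free tournament that is not 2-colourable has all in-degrees at least 2. In a
  minimal vertex set \<open>U\<close> with this property every vertex has an out-neighbour of in-degree exactly 2,
  so the vertices of in-degree 2 in \<open>U\<close> span a cyclic triangle; looking at the second in-neighbours of
  its vertices yields the regular tournament \<open>T5\<close> or \<open>P6\<close>, that is \<open>P7\<close> minus a vertex.

  A copy of \<open>T5\<close> is a module, so a 2-colouring of the tournament in which only a cyclic triangle of it
  is kept uses both colours on the triangle and therefore extends. A copy of \<open>P6\<close> consists of two
  cyclic triangles \<open>A\<close> and \<open>B\<close> with all arcs from \<open>A\<close> to \<open>B\<close> except for a matching directed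
  from \<open>B\<close> to \<open>A\<close>; every vertex outside is uniform on \<open>A\<close> and on \<open>B\<close>, and it completes a \<open>P7\<close>
  if it is dominated by \<open>B\<close> and dominates \<open>A\<close>. Without a \<open>P7\<close>, reversing the matching
  creates neither a \<open>\<Delta>(1,2,2)\<close> nor a \<open>P7\<close>, loses cyclic triangles, and a 2-colouring of the new
  tournament can be repaired on \<open>A \<union> B\<close>. Induction on the number of vertices plus the number of
  cyclic triangles finishes the 2-colourable case.

  For three colours, take a minimal set \<open>X\<close> meeting every copy of \<open>P7\<close>: the rest is 2-colourable, and
  copies of \<open>P7\<close> being modules, a cyclic triangle in \<open>X\<close> would blow up to a \<open>\<Delta>(1,2,2)\<close>.
\<close>

section \<open>Arc relations, and how outside vertices see a copy of \<open>T5\<close> or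
  \<open>P6\<close>\<close>

locale rel_tournament =
  fixes V :: "'a set" and E :: "'a \<Rightarrow> 'a \<Rightarrow> bool"
  assumes fin: "finite V"
    and asym: "E u v \<Longrightarrow> \<not> E v u"
    and total: "u \<in> V \<Longrightarrow> v \<in> V \<Longrightarrow> u \<noteq> v \<Longrightarrow> E u v \<or> E v u"

text \<open>The variables range over the whole type, so the property passes to every subset of
  \<open>V\<close> with the same \<open>E\<close>. For asymmetric \<open>E\<close> the five vertices
  are automatically distinct, any two of them being joined by an arc.\<close>

definition delta_free :: "('a \<Rightarrow> 'a \<Rightarrow> bool) \<Rightarrow> bool" where
  "delta_free E \<longleftrightarrow> (\<forall>x y y' z z'. \<not> (E x y \<and> E x y' \<and> E y y' \<and> E y z \<and> E y z' \<and>
    E y' z \<and> E y' z' \<and> E z z' \<and> E z x \<and> E z' x))"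

lemma delta_freeD:
  "\<lbrakk>delta_free E; E x y; E x y'; E y y'; E y z; E y z'; E y' z; E y' z'; E z z'; E z x; E z' x\<rbrakk>
    \<Longrightarrow> False"
  unfolding delta_free_def by blast

text \<open>A tournament is transitive iff it has no cyclic triangle, so forbidding monochromatic
  cyclic triangles makes every colour class transitive. The type of colours is left open:
  \<open>bool\<close> serves for two colours, \<open>nat\<close> for three.\<close>

definition proper :: "'a set \<Rightarrow> ('a \<Rightarrow> 'a \<Rightarrow> bool) \<Rightarrow> ('a \<Rightarrow> 'c) \<Rightarrow> bool" where
  "proper V E f \<longleftrightarrow> (\<forall>x\<in>V. \<forall>y\<in>V. \<forall>z\<in>V. E x y \<and> E y z \<and> E z x \<longrightarrow> \<not> (f x = f y \<and> f y = f z))"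

text \<open>In the cyclic order \<open>a, b, c, d, e\<close> every vertex beats the next
  two.\<close>

definition T5 :: "('a \<Rightarrow> 'a \<Rightarrow> bool) \<Rightarrow> 'a \<Rightarrow> 'a \<Rightarrow> 'a \<Rightarrow> 'a \<Rightarrow> 'a \<Rightarrow> bool" where
  "T5 E a b c d e \<longleftrightarrow> E a b \<and> E a c \<and> E b c \<and> E b d \<and> E c d \<and> E c e \<and> E d e \<and> E d a \<and> E e a \<and> E e b"

text \<open>The two triangles run in opposite senses of the indices; the matching consists of the
  arcs from each \<open>b\<close> to the \<open>a\<close> of the same index.\<close>

definition P6 :: "('a \<Rightarrow> 'a \<Rightarrow> bool) \<Rightarrow> 'a \<Rightarrow> 'a \<Rightarrow> 'a \<Rightarrow> 'a \<Rightarrow> 'a \<Rightarrow> 'a \<Rightarrow> bool" where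
  "P6 E a1 a2 a3 b1 b2 b3 \<longleftrightarrow> E a1 a2 \<and> E a2 a3 \<and> E a3 a1 \<and> E b1 b3 \<and> E b3 b2 \<and> E b2 b1 \<and>
    E b1 a1 \<and> E b2 a2 \<and> E b3 a3 \<and> E a1 b2 \<and> E a1 b3 \<and> E a2 b1 \<and> E a2 b3 \<and> E a3 b1 \<and> E a3 b2"

text \<open>Copies of \<open>P7\<close> are indexed by all integers, with period 7, so that rotations are shifts.\<close>

definition P7_embedding :: "('a \<Rightarrow> 'a \<Rightarrow> bool) \<Rightarrow> (int \<Rightarrow> 'a) \<Rightarrow> bool" where
  "P7_embedding E h \<longleftrightarrow>
    (\<forall>i. h (i + 7) = h i \<and> E (h i) (h (i + 1)) \<and> E (h i) (h (i + 2)) \<and> E (h i) (h (i + 4)))"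

lemma T5_rotate: "T5 E a b c d e \<Longrightarrow> T5 E b c d e a"
  unfolding T5_def by blast

lemma P6_rotate: "P6 E a1 a2 a3 b1 b2 b3 \<Longrightarrow> P6 E a2 a3 a1 b2 b3 b1"
  unfolding P6_def by blast

context rel_tournament
begin

lemma irrefl: "\<not> E u u"
  using asym by blast

text \<open>Otherwise \<open>E v b\<close>. If \<open>E d v\<close>, either direction between
  \<open>c\<close> and \<open>v\<close> yields a \<Delta>(1,2,2). If \<open>E v d\<close>, then
  \<open>E e v\<close> yields one at once, and \<open>E v e\<close> yields one for either direction
  between \<open>c\<close> and \<open>v\<close>.\<close>

lemma T5_step:
  assumes "delta_free E" "T5 E a b c d e" "{a, b, c, d, e} \<subseteq> V" "v \<in> V - {a, b, c, d, e}" "E a v"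
  shows "E b v"
proof (rule ccontr)
  assume "\<not> E b v"
  then have "E v b" "E c v \<or> E v c" "E d v \<or> E v d" "E e v \<or> E v e"
    using total assms by auto
  then show False
    using assms(2,5)
      delta_freeD[OF assms(1), of a c v d e] delta_freeD[OF assms(1), of a v c d e]
      delta_freeD[OF assms(1), of b c d e v] delta_freeD[OF assms(1), of b c d v e]
      delta_freeD[OF assms(1), of d a v b c] delta_freeD[OF assms(1), of d e a v b]
    unfolding T5_def by blast
qed

text \<open>The rotations of \<open>T5_step\<close> close a cycle of implications through all five
  vertices; totality then converts out-arcs into in-arcs.\<close>

lemma T5_module:
  assumes "delta_free E" "T5 E a b c d e" "{a, b, c, d, e} \<subseteq> V" "v \<in> V - {a, b, c, d, e}"
    and s: "s \<in> {a, b, c, d, e}" and t: "t \<in> {a, b, c, d, e}"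
  shows "E s v \<longleftrightarrow> E t v" and "E v s \<longleftrightarrow> E v t"
proof -
  note r1 = T5_rotate[OF assms(2)]
  note r2 = T5_rotate[OF r1]
  note r3 = T5_rotate[OF r2]
  note r4 = T5_rotate[OF r3]
  have "E a v \<Longrightarrow> E b v" "E b v \<Longrightarrow> E c v" "E c v \<Longrightarrow> E d v" "E d v \<Longrightarrow> E e v" "E e v \<Longrightarrow> E a v"
    using T5_step[OF assms(1) assms(2), of v] T5_step[OF assms(1) r1, of v]
      T5_step[OF assms(1) r2, of v] T5_step[OF assms(1) r3, of v] T5_step[OF assms(1) r4, of v]
      assms(3,4) by (simp_all add: insert_commute)
  then show *: "E s v \<longleftrightarrow> E t v"
    using s t by blast
  have "E v s \<longleftrightarrow> \<not> E s v" "E v t \<longleftrightarrow> \<not> E t v"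
    using asym total[of s v] total[of t v] assms(3,4) s t by blast+
  with * show "E v s \<longleftrightarrow> E v t"
    by simp
qed

text \<open>Otherwise \<open>E a2 v\<close>. If \<open>E b2 v\<close>, either direction between
  \<open>b1\<close> and \<open>v\<close> gives a \<Delta>(1,2,2) with single vertex
  \<open>a1\<close>; if \<open>E v b2\<close>, either direction between \<open>a3\<close> and
  \<open>v\<close> gives one with single vertex \<open>a2\<close>.\<close>

lemma P6_step_source:
  assumes "delta_free E" "P6 E a1 a2 a3 b1 b2 b3" "{a1, a2, a3, b1, b2, b3} \<subseteq> V"
    and "v \<in> V - {a1, a2, a3, b1, b2, b3}" "E v a1"
  shows "E v a2"
proof (rule ccontr)
  assume "\<not> E v a2"
  then have "E a2 v" "E a3 v \<or> E v a3" "E b1 v \<or> E v b1" "E b2 v \<or> E v b2"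
    using total assms by auto
  then show False
    using assms(2,5)
      delta_freeD[OF assms(1), of a1 b2 a2 b1 v] delta_freeD[OF assms(1), of a1 b2 a2 v b1]
      delta_freeD[OF assms(1), of a2 a3 v a1 b2] delta_freeD[OF assms(1), of a2 v a3 a1 b2]
    unfolding P6_def by blast
qed

text \<open>The same scheme, now branching on the arc between \<open>a1\<close> and
  \<open>v\<close>; the single vertices are \<open>b1\<close> and \<open>b3\<close>.\<close>

lemma P6_step_sink:
  assumes "delta_free E" "P6 E a1 a2 a3 b1 b2 b3" "{a1, a2, a3, b1, b2, b3} \<subseteq> V"
    and "v \<in> V - {a1, a2, a3, b1, b2, b3}" "E v b1"
  shows "E v b3"
proof (rule ccontr)
  assume "\<not> E v b3"
  then have "E b3 v" "E a1 v \<or> E v a1" "E a3 v \<or> E v a3" "E b2 v \<or> E v b2"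
    using total assms by auto
  then show False
    using assms(2,5)
      delta_freeD[OF assms(1), of b1 a1 b3 b2 v] delta_freeD[OF assms(1), of b1 a1 b3 v b2]
      delta_freeD[OF assms(1), of b3 a3 v b1 a1] delta_freeD[OF assms(1), of b3 v a3 b1 a1]
    unfolding P6_def by blast
qed

lemma P6_modules:
  assumes "delta_free E" "P6 E a1 a2 a3 b1 b2 b3" "{a1, a2, a3, b1, b2, b3} \<subseteq> V"
    and v: "v \<in> V - {a1, a2, a3, b1, b2, b3}"
    and st: "s \<in> {a1, a2, a3} \<and> t \<in> {a1, a2, a3} \<or> s \<in> {b1, b2, b3} \<and> t \<in> {b1, b2, b3}"
  shows "E v s \<longleftrightarrow> E v t" and "E s v \<longleftrightarrow> E t v"
proof -
  note r1 = P6_rotate[OF assms(2)]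
  note r2 = P6_rotate[OF r1]
  have "E v a1 \<Longrightarrow> E v a2" "E v a2 \<Longrightarrow> E v a3" "E v a3 \<Longrightarrow> E v a1"
    "E v b1 \<Longrightarrow> E v b3" "E v b3 \<Longrightarrow> E v b2" "E v b2 \<Longrightarrow> E v b1"
    using P6_step_source[OF assms(1) assms(2), of v] P6_step_source[OF assms(1) r1, of v]
      P6_step_source[OF assms(1) r2, of v] P6_step_sink[OF assms(1) assms(2), of v]
      P6_step_sink[OF assms(1) r1, of v] P6_step_sink[OF assms(1) r2, of v] assms(3,4)
    by (simp_all add: insert_commute)
  then show *: "E v s \<longleftrightarrow> E v t"
    using st by blast
  have "E s v \<longleftrightarrow> \<not> E v s" "E t v \<longleftrightarrow> \<not> E v t"
    using asym total[of s v] total[of t v] assms(3,4) st by blast+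
  with * show "E s v \<longleftrightarrow> E t v"
    by simp
qed

text \<open>Take \<open>x\<close> of least out-degree in \<open>W\<close> and an out-neighbour
  \<open>y\<close>. The out-neighbourhood of \<open>y\<close> cannot lie inside that of
  \<open>x\<close>, since it would be a proper part of it (\<open>y\<close> is missing); a vertex of
  the difference closes the triangle.\<close>

lemma cyclic_triangle_if_no_sink:
  assumes "W \<subseteq> V" "W \<noteq> {}" and out: "\<And>v. v \<in> W \<Longrightarrow> \<exists>w\<in>W. E v w"
  obtains x y z where "x \<in> W" "y \<in> W" "z \<in> W" "E x y" "E y z" "E z x"
proof -
  have finW: "finite W"
    using assms(1) fin finite_subset by blast
  define N where "N v = {w \<in> W. E v w}" for v
  obtain x where x: "x \<in> W" and min: "\<And>v. v \<in> W \<Longrightarrow> card (N x) \<le> card (N v)"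
    using ex_has_least_nat[of "\<lambda>v. v \<in> W" _ "\<lambda>v. card (N v)"] assms(2) by blast
  obtain y where y: "y \<in> W" "E x y"
    using out x by blast
  have "\<not> N y \<subseteq> N x"
  proof
    assume "N y \<subseteq> N x"
    then have "N y \<subset> N x"
      using y irrefl[of y] unfolding N_def by auto
    then have "card (N y) < card (N x)"
      using finW by (intro psubset_card_mono) (auto simp: N_def)
    then show False
      using min[OF y(1)] by simp
  qed
  then obtain z where z: "z \<in> W" "E y z" "\<not> E x z"
    unfolding N_def by blast
  moreover have "z \<noteq> x"
    using z y asym by blast
  ultimately have "E z x"
    using total[of x z] x assms(1) by blast
  then show thesis
    using that x y z by blast
qed

end

section \<open>Tournaments with in-degrees at least 2 contain \<open>T5\<close> or
  \<open>P6\<close>\<close>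

context rel_tournament
begin

text \<open>In a smallest set \<open>U\<close> with all in-degrees at least \<open>k\<close>,
  deleting \<open>v\<close> must push some \<open>w\<close> below \<open>k\<close>. So
  \<open>v\<close> was an in-neighbour of \<open>w\<close>, and \<open>w\<close> had exactly
  \<open>k\<close> of them.\<close>

lemma obtain_minimal_indegree:
  assumes "V \<noteq> {}" and deg: "\<And>v. v \<in> V \<Longrightarrow> k \<le> card {u \<in> V. E u v}" and "k > 0"
  obtains U where "U \<subseteq> V" "U \<noteq> {}"
    and "\<And>v. v \<in> U \<Longrightarrow> k \<le> card {u \<in> U. E u v}"
    and "\<And>v. v \<in> U \<Longrightarrow> \<exists>w\<in>U. E v w \<and> card {u \<in> U. E u w} = k"
proof -
  define good where "good U \<longleftrightarrow> U \<subseteq> V \<and> U \<noteq> {} \<and> (\<forall>v\<in>U. k \<le> card {u \<in> U. E u v})" for U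
  have "good V"
    using assms unfolding good_def by blast
  then obtain U where U: "good U" and min: "\<And>U'. good U' \<Longrightarrow> card U \<le> card U'"
    using ex_has_least_nat[of good _ card] by blast
  have finU: "finite U"
    using U fin finite_subset unfolding good_def by blast
  have "\<exists>w\<in>U. E v w \<and> card {u \<in> U. E u w} = k" if v: "v \<in> U" for v
  proof -
    have "{u \<in> U. E u v} \<noteq> {}"
      using U v \<open>k > 0\<close> unfolding good_def by (metis card.empty not_less)
    then have "U - {v} \<noteq> {}"
      using irrefl by blast
    moreover have "\<not> good (U - {v})"
      using min[of "U - {v}"] card_Diff1_less[OF finU v] by auto
    ultimately obtain w where w: "w \<in> U" "w \<noteq> v" "card {u \<in> U - {v}. E u w} < k"
      using U unfolding good_def by (auto simp: not_le)
    have le: "k \<le> card {u \<in> U. E u w}"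
      using U w unfolding good_def by blast
    have "E v w"
    proof (rule ccontr)
      assume "\<not> E v w"
      then have "{u \<in> U - {v}. E u w} = {u \<in> U. E u w}"
        by blast
      with w le show False by simp
    qed
    then have "{u \<in> U. E u w} = insert v {u \<in> U - {v}. E u w}"
      using v by blast
    then have "card {u \<in> U. E u w} = Suc (card {u \<in> U - {v}. E u w})"
      using finU by (simp add: card_insert_disjoint)
    with w le \<open>E v w\<close> show ?thesis
      by (intro bexI[of _ w]) auto
  qed
  with U that show thesis
    unfolding good_def by blast
qed

lemma T5_or_P6:
  assumes ne: "V \<noteq> {}" and deg: "\<And>v. v \<in> V \<Longrightarrow> 2 \<le> card {u \<in> V. E u v}" and df: "delta_free E"
  shows "(\<exists>a b c d e. {a, b, c, d, e} \<subseteq> V \<and> T5 E a b c d e) \<or>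
    (\<exists>a1 a2 a3 b1 b2 b3. {a1, a2, a3, b1, b2, b3} \<subseteq> V \<and> P6 E a1 a2 a3 b1 b2 b3)"
proof -
  obtain U where U: "U \<subseteq> V" "U \<noteq> {}" "\<And>v. v \<in> U \<Longrightarrow> 2 \<le> card {u \<in> U. E u v}"
    and out: "\<And>v. v \<in> U \<Longrightarrow> \<exists>w\<in>U. E v w \<and> card {u \<in> U. E u w} = 2"
    by (rule obtain_minimal_indegree[OF ne deg]) auto
  define W where "W = {w \<in> U. card {u \<in> U. E u w} = 2}"
  have "W \<subseteq> V" "W \<noteq> {}"
    using U out unfolding W_def by blast+
  moreover have "\<exists>w\<in>W. E v w" if "v \<in> W" for v
    using out that unfolding W_def by blast
  ultimately obtain w1 w2 w3 where w: "w1 \<in> W" "w2 \<in> W" "w3 \<in> W" "E w1 w2" "E w2 w3" "E w3 w1"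
    by (rule cyclic_triangle_if_no_sink)
  then have wU: "w1 \<in> U" "w2 \<in> U" "w3 \<in> U"
    unfolding W_def by auto
  \<comment> \<open>Vertices of \<open>W\<close> have exactly two in-neighbours in \<open>U\<close>:
    besides a known one, \<open>p\<close>, there is a single further one, and all other vertices of
    \<open>U\<close> are beaten.\<close>
  have pred: "\<exists>b. b \<in> U \<and> E b v \<and> b \<noteq> p \<and> (\<forall>u\<in>U. u \<noteq> p \<longrightarrow> u \<noteq> b \<longrightarrow> u \<noteq> v \<longrightarrow> E v u)"
    if "v \<in> W" "p \<in> U" "E p v" for v p
  proof -
    obtain b c where bc: "{u \<in> U. E u v} = {b, c}" "b \<noteq> c"
      using \<open>v \<in> W\<close> unfolding W_def by (auto simp: card_2_iff)
    have v: "E v u" if "u \<in> U" "u \<noteq> b" "u \<noteq> c" "u \<noteq> v" for u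
      using total[of u v] that bc \<open>v \<in> W\<close> U(1) unfolding W_def by blast
    have "p = b \<or> p = c" "b \<in> U" "c \<in> U" "E b v" "E c v"
      using that bc by blast+
    with v bc(2) show ?thesis
      by (elim disjE) (intro exI[of _ c] exI[of _ b]; simp)+
  qed
  obtain b1 where b1: "b1 \<in> U" "E b1 w1" "b1 \<noteq> w3"
    "\<And>u. u \<in> U \<Longrightarrow> u \<noteq> w3 \<Longrightarrow> u \<noteq> b1 \<Longrightarrow> u \<noteq> w1 \<Longrightarrow> E w1 u"
    using pred[OF w(1) wU(3) w(6)] by blast
  obtain b2 where b2: "b2 \<in> U" "E b2 w2" "b2 \<noteq> w1"
    "\<And>u. u \<in> U \<Longrightarrow> u \<noteq> w1 \<Longrightarrow> u \<noteq> b2 \<Longrightarrow> u \<noteq> w2 \<Longrightarrow> E w2 u"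
    using pred[OF w(2) wU(1) w(4)] by blast
  obtain b3 where b3: "b3 \<in> U" "E b3 w3" "b3 \<noteq> w2"
    "\<And>u. u \<in> U \<Longrightarrow> u \<noteq> w2 \<Longrightarrow> u \<noteq> b3 \<Longrightarrow> u \<noteq> w3 \<Longrightarrow> E w3 u"
    using pred[OF w(3) wU(2) w(5)] by blast
  have ne: "w1 \<noteq> w2" "w2 \<noteq> w3" "w3 \<noteq> w1" "b1 \<noteq> w1" "b2 \<noteq> w2" "b3 \<noteq> w3"
    using irrefl w(4-6) b1(2) b2(2) b3(2) by blast+
  have ne': "b1 \<noteq> w2" "b2 \<noteq> w3" "b3 \<noteq> w1"
    using asym[OF w(4)] asym[OF w(5)] asym[OF w(6)] b1(2) b2(2) b3(2) by blast+
  have sub: "{w1, w2, w3, b1, b2, b3} \<subseteq> V"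
    using wU b1(1) b2(1) b3(1) U(1) by blast
  \<comment> \<open>The pattern left when exactly two second in-neighbours coincide:
    \<open>b\<close> is the shared one and \<open>c\<close> the other. The arc from \<open>b\<close>
    to \<open>c\<close> would give a \<Delta>(1,2,2), and the opposite arc completes a
    \<open>T5\<close>.\<close>
  have T5: "\<exists>a b c d e. {a, b, c, d, e} \<subseteq> V \<and> T5 E a b c d e"
    if "E x y" "E y z" "E z x" "E b x" "E b y" "E z b" "E c z" "E x c" "E y c" "b \<noteq> c"
      "{x, y, z, b, c} \<subseteq> V" for x y z b c
  proof -
    have "\<not> E b c"
      using delta_freeD[OF df, of z b x y c] that(1-9) by blast
    then have "T5 E x y c z b"
      using that(1-10) total[of b c] that(11) unfolding T5_def by auto
    then show ?thesis
      using that(11) by (intro exI[of _ x] exI[of _ y] exI[of _ c] exI[of _ z] exI[of _ b]) auto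
  qed
  show ?thesis
  proof (cases "b1 = b2 \<or> b2 = b3 \<or> b3 = b1")
    case True
    show ?thesis
    proof (cases "b1 = b2 \<and> b2 = b3")
      case True
      \<comment> \<open>Here one vertex dominates the whole triangle. Two of its own in-neighbours
        in \<open>U\<close> are beaten by \<open>w1\<close> and \<open>w2\<close>, which gives a
        \<Delta>(1,2,2).\<close>
      have "\<not> card {u \<in> U. E u b1} \<le> Suc 0" "finite {u \<in> U. E u b1}"
        using U(3)[OF b1(1)] fin finite_subset[OF U(1)] by auto
      then obtain p0 q0 where "p0 \<noteq> q0" "E p0 b1" "E q0 b1" "p0 \<in> U" "q0 \<in> U"
        by (auto simp: card_le_Suc0_iff_eq)
      then obtain p q where pq: "E p b1" "E q b1" "p \<in> U" "q \<in> U" "E p q"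
        using total[of p0 q0] U(1) by blast
      have "p \<notin> {w1, w2, w3, b1}" "q \<notin> {w1, w2, w3, b1}"
        using pq True b1(2) b2(2) b3(2) asym irrefl by blast+
      then have "E w1 p" "E w1 q" "E w2 p" "E w2 q"
        using b1(4)[of p] b1(4)[of q] b2(4)[of p] b2(4)[of q] pq(3,4) True by auto
      then show ?thesis
        using delta_freeD[OF df, of b1 w1 w2 p q] w(4) pq b1(2) b2(2) True by blast
    next
      case False
      then consider "b1 = b2" "b2 \<noteq> b3" | "b2 = b3" "b3 \<noteq> b1" | "b3 = b1" "b1 \<noteq> b2"
        using True by blast
      then show ?thesis
      proof cases
        case 1
        then have "E w3 b1" "E w1 b3" "E w2 b3"
          using wU b1(1,3,4) b2(1,3,4) b3(1,3,4) ne ne' by auto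
        then have "\<exists>a b c d e. {a, b, c, d, e} \<subseteq> V \<and> T5 E a b c d e"
          using 1 w(4-6) b1(2) b2(2) b3(2) sub by (intro T5[of w1 w2 w3 b1 b3]) auto
        then show ?thesis ..
      next
        case 2
        then have "E w1 b2" "E w2 b1" "E w3 b1"
          using wU b1(1,3,4) b2(1,3,4) b3(1,3,4) ne ne' by auto
        then have "\<exists>a b c d e. {a, b, c, d, e} \<subseteq> V \<and> T5 E a b c d e"
          using 2 w(4-6) b1(2) b2(2) b3(2) sub by (intro T5[of w2 w3 w1 b2 b1]) auto
        then show ?thesis ..
      next
        case 3
        then have "E w2 b3" "E w3 b2" "E w1 b2"
          using wU b1(1,3,4) b2(1,3,4) b3(1,3,4) ne ne' by auto
        then have "\<exists>a b c d e. {a, b, c, d, e} \<subseteq> V \<and> T5 E a b c d e"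
          using 3 w(4-6) b1(2) b2(2) b3(2) sub by (intro T5[of w3 w1 w2 b3 b2]) auto
        then show ?thesis ..
      qed
    qed
  next
    case False
    then have W: "E w1 b2" "E w1 b3" "E w2 b1" "E w2 b3" "E w3 b1" "E w3 b2"
      using wU b1(1,3,4) b2(1,3,4) b3(1,3,4) ne ne' by auto
    \<comment> \<open>With three distinct second in-neighbours only the arcs among them are open.
      Each arc in the wrong sense completes a \<Delta>(1,2,2), so they form the oppositely oriented
      triangle of \<open>P6\<close>.\<close>
    have "\<not> E b1 b2" "\<not> E b2 b3" "\<not> E b3 b1"
      using delta_freeD[OF df, of w2 w3 b1 w1 b2] delta_freeD[OF df, of w3 w1 b2 w2 b3]
        delta_freeD[OF df, of w1 w2 b3 w3 b1] W w(4-6) b1(2) b2(2) b3(2) by blast+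
    moreover from this have "E b2 b1" "E b3 b2" "E b1 b3"
      using False total sub by auto
    ultimately have "P6 E w1 w2 w3 b1 b2 b3"
      using W w(4-6) b1(2) b2(2) b3(2) unfolding P6_def by simp
    then show ?thesis
      using sub by blast
  qed
qed

end

section \<open>Recolouring a part of the vertex set\<close>

lemma (in rel_tournament) transitive_triple:
  assumes "E p q" "E q r" "E p r" and "x \<in> {p, q, r}" "y \<in> {p, q, r}" "z \<in> {p, q, r}"
    and "E x y" "E y z" "E z x"
  shows False
proof -
  have "\<not> E q p" "\<not> E r q" "\<not> E r p"
    using asym assms(1-3) by blast+
  with assms(4-9) show False
    by (elim insertE emptyE) (simp_all add: irrefl)
qed

text \<open>Cyclic triangles may be rotated, so only the number of their vertices in
  \<open>S\<close> matters; the four premises treat 0, 1, 2 and 3. In the third, the colour of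
  \<open>v\<close> is dropped, since the applications refute the triangle from the arcs and the
  colours inside \<open>S\<close>.\<close>

lemma proper_patch:
  assumes "\<And>x y z. \<lbrakk>x \<in> V - S; y \<in> V - S; z \<in> V - S; E x y; E y z; E z x; f x = f y; f y = f z\<rbrakk> \<Longrightarrow> False"
    and "\<And>s u v. \<lbrakk>s \<in> S; u \<in> V - S; v \<in> V - S; E s u; E u v; E v s; g s = f u; f u = f v\<rbrakk> \<Longrightarrow> False"
    and "\<And>s t v. \<lbrakk>s \<in> S; t \<in> S; v \<in> V - S; E s t; E t v; E v s; g s = g t\<rbrakk> \<Longrightarrow> False"
    and "\<And>x y z. \<lbrakk>x \<in> S; y \<in> S; z \<in> S; E x y; E y z; E z x; g x = g y; g y = g z\<rbrakk> \<Longrightarrow> False"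
  shows "proper V E (\<lambda>v. if v \<in> S then g v else f v)"
  unfolding proper_def
proof (intro ballI impI notI; elim conjE)
  fix x y z
  let ?c = "\<lambda>v. if v \<in> S then g v else f v"
  assume xyz: "x \<in> V" "y \<in> V" "z \<in> V" "E x y" "E y z" "E z x" "?c x = ?c y" "?c y = ?c z"
  consider "x \<notin> S" "y \<notin> S" "z \<notin> S" | "x \<in> S" "y \<notin> S" "z \<notin> S" | "y \<in> S" "z \<notin> S" "x \<notin> S"
    | "z \<in> S" "x \<notin> S" "y \<notin> S" | "x \<in> S" "y \<in> S" "z \<notin> S" | "y \<in> S" "z \<in> S" "x \<notin> S"
    | "z \<in> S" "x \<in> S" "y \<notin> S" | "x \<in> S" "y \<in> S" "z \<in> S"
    by argo
  then show False
  proof cases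
    case 1 with xyz show ?thesis by (intro assms(1)[of x y z]) simp_all
  next
    case 2 with xyz show ?thesis by (intro assms(2)[of x y z]) simp_all
  next
    case 3 with xyz show ?thesis by (intro assms(2)[of y z x]) simp_all
  next
    case 4 with xyz show ?thesis by (intro assms(2)[of z x y]) simp_all
  next
    case 5 with xyz show ?thesis by (intro assms(3)[of x y z]) simp_all
  next
    case 6 with xyz show ?thesis by (intro assms(3)[of y z x]) simp_all
  next
    case 7 with xyz show ?thesis by (intro assms(3)[of z x y]) simp_all
  next
    case 8 with xyz show ?thesis by (intro assms(4)[of x y z]) simp_all
  qed
qed

subsection \<open>Copies of the Paley tournament\<close>

lemma P7_embedding_mod:
  assumes "P7_embedding E h" "j mod 7 = i mod 7"
  shows "h j = h i"
proof -
  have step: "h (i + 7) = h i" for i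
    using assms(1) unfolding P7_embedding_def by blast
  have up: "h (i + 7 * int n) = h i" for i n
  proof (induction n)
    case (Suc n)
    then show ?case
      using step[of "i + 7 * int n"] by (simp add: algebra_simps)
  qed simp
  obtain k where k: "j = i + 7 * k"
    using assms(2) by (metis add.commute mod_eqE)
  show ?thesis
  proof (cases "k \<ge> 0")
    case True
    then show ?thesis
      using up[of i "nat k"] k by simp
  next
    case False
    then show ?thesis
      using up[of j "nat (- k)"] k by simp
  qed
qed

lemma P7_embedding_arc:
  assumes "P7_embedding E h" "(j - i) mod 7 \<in> {1, 2, 4}"
  shows "E (h i) (h j)"
proof -
  have "h j = h (i + (j - i) mod 7)"
    by (rule P7_embedding_mod[OF assms(1)]) (simp add: mod_simps)
  then show ?thesis
    using assms unfolding P7_embedding_def by auto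
qed

text \<open>1, 2, 4 are the nonzero squares modulo 7 and closed under multiplication, so these
  affine maps are automorphisms of \<open>P7\<close>.\<close>

lemma P7_embedding_affine:
  assumes h: "P7_embedding E h" and "c \<in> {1, 2, 4}"
  shows "P7_embedding E (\<lambda>j. h (i + c * j))"
  unfolding P7_embedding_def
proof (intro allI conjI)
  fix j
  show "h (i + c * (j + 7)) = h (i + c * j)"
    using mod_mult_self1[of "i + c * j" c 7] by (intro P7_embedding_mod[OF h]) (simp add: algebra_simps)
  show "E (h (i + c * j)) (h (i + c * (j + 1)))" "E (h (i + c * j)) (h (i + c * (j + 2)))"
    "E (h (i + c * j)) (h (i + c * (j + 4)))"
    using \<open>c \<in> {1, 2, 4}\<close> by (intro P7_embedding_arc[OF h]; force simp: algebra_simps)+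
qed

lemma P7_embedding_range:
  assumes "P7_embedding E h"
  shows "range h = {h i, h (i + 1), h (i + 2), h (i + 3), h (i + 4), h (i + 5), h (i + 6)}"
    (is "_ = ?R")
proof
  show "range h \<subseteq> ?R"
  proof
    fix u assume "u \<in> range h"
    then obtain j where j: "u = h j"
      by blast
    moreover have "h j = h (i + (j - i) mod 7)"
      by (rule P7_embedding_mod[OF assms]) (simp add: mod_simps)
    moreover have "(j - i) mod 7 \<in> {0, 1, 2, 3, 4, 5, 6}"
      using pos_mod_bound[of 7 "j - i"] pos_mod_sign[of 7 "j - i"] by auto
    ultimately show "u \<in> ?R"
      by auto
  qed
qed blast

text \<open>Deleting \<open>h i\<close> leaves a \<open>P6\<close>: the first triangle consists of
  its out-neighbours, the second of its in-neighbours, and matched vertices have opposite offsets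
  from \<open>i\<close>.\<close>

lemma P7_embedding_P6:
  assumes "P7_embedding E h"
  shows "P6 E (h (i + 1)) (h (i + 2)) (h (i + 4)) (h (i + 6)) (h (i + 5)) (h (i + 3))"
  unfolding P6_def by (intro conjI P7_embedding_arc[OF assms]) simp_all

lemma P7_embeddingI:
  assumes "P6 E a1 a2 a3 b1 b2 b3"
    and "\<forall>a\<in>{a1, a2, a3}. E v a" "\<forall>b\<in>{b1, b2, b3}. E b v"
  shows "\<exists>h. P7_embedding E h"
proof -
  \<comment> \<open>The positions are those of \<open>P7_embedding_P6\<close> at
    \<open>i = 0\<close>: \<open>v\<close> at 0, the out-neighbours at 1, 2, 4, and
    \<open>b1, b2, b3\<close> at 6, 5, 3.\<close>
  let ?l = "[v, a1, a2, b3, a3, b2, b1]"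
  let ?h = "\<lambda>i::int. ?l ! nat (i mod 7)"
  have "P7_embedding E ?h"
    unfolding P7_embedding_def
  proof (intro allI)
    fix i :: int
    have i: "(i + k) mod 7 = (i mod 7 + k) mod 7" for k
      by (simp add: mod_simps)
    have "i mod 7 \<in> {0, 1, 2, 3, 4, 5, 6}"
      using pos_mod_bound[of 7 i] pos_mod_sign[of 7 i] by auto
    then show "?h (i + 7) = ?h i \<and> E (?h i) (?h (i + 1)) \<and> E (?h i) (?h (i + 2)) \<and> E (?h i) (?h (i + 4))"
      using assms unfolding P6_def i by auto
  qed
  then show ?thesis
    by blast
qed

text \<open>Multiplication by 2 and 4 maps \<open>P7\<close> to itself, so only the module closure of \<open>{0, 1}\<close> is computed.\<close>

lemma P7_prime:
  assumes h: "P7_embedding E h" and asym: "\<And>u v. E u v \<Longrightarrow> \<not> E v u"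
    and hom: "\<And>u s t. \<lbrakk>u \<in> range h; u \<notin> H; s \<in> H; t \<in> H; E s u\<rbrakk> \<Longrightarrow> E t u"
    and ij: "h i \<in> H" "h j \<in> H" "h i \<noteq> h j"
  shows "range h \<subseteq> H"
proof -
  have base: "range k \<subseteq> H" if k: "P7_embedding E k" "range k \<subseteq> range h" "k 0 \<in> H" "k 1 \<in> H" for k
  proof -
    note arc = P7_embedding_arc[OF k(1)]
    \<comment> \<open>The middle of a directed 2-path with both ends in \<open>H\<close> lies in
      \<open>H\<close>; in the order 3, 4, 5, 2, 6 each vertex has such a path available.\<close>
    have inH: "w \<in> H" if "s \<in> H" "t \<in> H" "E s w" "E w t" "w \<in> range k" for s t w
      using hom[of w s t] asym that k(2) by blast
    have k3: "k 3 \<in> H"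
      by (rule inH[OF k(4) k(3)]) (simp_all add: arc)
    have k4: "k 4 \<in> H"
      by (rule inH[OF k(3) k(4)]) (simp_all add: arc)
    have k5: "k 5 \<in> H"
      by (rule inH[OF k(4) k(3)]) (simp_all add: arc)
    have k2: "k 2 \<in> H"
      by (rule inH[OF k(4) k3]) (simp_all add: arc)
    have k6: "k 6 \<in> H"
      by (rule inH[OF k4 k(3)]) (simp_all add: arc)
    show ?thesis
      using P7_embedding_range[OF k(1), of 0] k(3,4) k2 k3 k4 k5 k6 by simp
  qed
  have affine: "range h \<subseteq> H"
    if c: "c \<in> {1, 2, 4}" and "(l - i) mod 7 = c" "h i \<in> H" "h l \<in> H" for c i l
  proof -
    have "h (i + c) = h l"
      unfolding that(2)[symmetric] by (rule P7_embedding_mod[OF h]) (simp add: mod_simps)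
    then have *: "range (\<lambda>j. h (i + c * j)) \<subseteq> H"
      using that by (intro base[OF P7_embedding_affine[OF h c]]) auto
    show ?thesis
    proof
      fix u assume "u \<in> range h"
      then obtain m where m: "u = h m"
        by blast
      \<comment> \<open>\<open>d\<close> is the inverse of \<open>c\<close> modulo 7, so the affine
        copy covers all of \<open>range h\<close>.\<close>
      obtain d :: int where "c * d = 1 \<or> c * d = 8"
      proof -
        have "1 * 1 = (1::int)" "2 * 4 = (8::int)" "4 * 2 = (8::int)"
          by simp_all
        then show thesis
          using that c by blast
      qed
      define e where "e = c * (d * (m - i))"
      have "e = (c * d) * (m - i)"
        unfolding e_def by (simp only: mult.assoc)
      with \<open>c * d = 1 \<or> c * d = 8\<close> have "i + e = m \<or> i + e = m + (m - i) * 7"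
        by (elim disjE) simp_all
      then have "m mod 7 = (i + e) mod 7"
        by (metis mod_mult_self1)
      then have "h m = h (i + c * (d * (m - i)))"
        unfolding e_def by (rule P7_embedding_mod[OF h])
      with m * show "u \<in> H"
        by blast
    qed
  qed
  define r where "r = (j - i) mod 7"
  have r: "r \<in> {0, 1, 2, 3, 4, 5, 6}"
    using pos_mod_bound[of 7 "j - i"] pos_mod_sign[of 7 "j - i"] unfolding r_def by auto
  have "r \<noteq> 0"
    using P7_embedding_mod[OF h, of j i] ij(3) unfolding r_def by (auto simp: mod_eq_dvd_iff)
  moreover have "(i - j) mod 7 = (- r) mod 7"
    unfolding r_def by (simp add: mod_simps)
  \<comment> \<open>-1 is not a square modulo 7, so exactly one of a nonzero \<open>r\<close> and
    its negative is a square.\<close>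
  ultimately have "r \<in> {1, 2, 4} \<or> (i - j) mod 7 \<in> {1, 2, 4}"
    using r by auto
  then show ?thesis
    using affine[of r j i] affine[of "(i - j) mod 7" i j] ij(1,2) unfolding r_def by blast
qed

context rel_tournament
begin

text \<open>Deleting \<open>h (i - 1)\<close> leaves a \<open>P6\<close> whose first triangle
  contains \<open>h i\<close> and \<open>h (i + 1)\<close>, so \<open>v\<close> cannot distinguish
  consecutive vertices.\<close>

lemma P7_module:
  assumes df: "delta_free E" and h: "P7_embedding E h" and sub: "range h \<subseteq> V"
    and v: "v \<in> V - range h" and s: "s \<in> range h" and t: "t \<in> range h"
  shows "E v s \<longleftrightarrow> E v t" and "E s v \<longleftrightarrow> E t v"
proof -
  have step: "E v (h (i + 1)) \<longleftrightarrow> E v (h i)" for i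
  proof -
    have "E v (h (i - 1 + 1)) \<longleftrightarrow> E v (h (i - 1 + 2))"
      by (rule P6_modules(1)[OF df P7_embedding_P6[OF h, of "i - 1"]]) (use sub v in auto)
    then show ?thesis
      by (simp add: algebra_simps)
  qed
  have "E v (h 1) \<longleftrightarrow> E v (h 0)" "E v (h 2) \<longleftrightarrow> E v (h 1)" "E v (h 3) \<longleftrightarrow> E v (h 2)"
    "E v (h 4) \<longleftrightarrow> E v (h 3)" "E v (h 5) \<longleftrightarrow> E v (h 4)" "E v (h 6) \<longleftrightarrow> E v (h 5)"
    using step[of 0] step[of 1] step[of 2] step[of 3] step[of 4] step[of 5] by simp_all
  then have "E v u \<longleftrightarrow> E v (h 0)" if "u \<in> range h" for u
    using that P7_embedding_range[OF h, of 0] by auto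
  then show *: "E v s \<longleftrightarrow> E v t"
    using s t by blast
  have "E s v \<longleftrightarrow> \<not> E v s" "E t v \<longleftrightarrow> \<not> E v t"
    using asym total[of s v] total[of t v] s t sub v by blast+
  with * show "E s v \<longleftrightarrow> E t v"
    by simp
qed

end

subsection \<open>Reversing the matching of a \<open>P6\<close>\<close>

text \<open>Ordered triples: each cyclic triangle counts three times, which is harmless in an
  induction measure.\<close>

definition cyclic_triples :: "'a set \<Rightarrow> ('a \<Rightarrow> 'a \<Rightarrow> bool) \<Rightarrow> ('a \<times> 'a \<times> 'a) set" where
  "cyclic_triples V E = {(x, y, z). x \<in> V \<and> y \<in> V \<and> z \<in> V \<and> E x y \<and> E y z \<and> E z x}"

lemma finite_cyclic_triples: "finite V \<Longrightarrow> finite (cyclic_triples V E)"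
  by (rule finite_subset[of _ "V \<times> V \<times> V"]) (auto simp: cyclic_triples_def)

lemma cyclic_triples_mono: "U \<subseteq> V \<Longrightarrow> cyclic_triples U E \<subseteq> cyclic_triples V E"
  unfolding cyclic_triples_def by blast

text \<open>The middle of a directed 2-path with both ends in \<open>H\<close> lies in
  \<open>H\<close>. The parts \<open>{x}\<close>, \<open>{y, y'}\<close>, \<open>{z, z'}\<close>
  dominate each other cyclically, so if \<open>H\<close> meets two parts it contains the third, and
  then everything.\<close>

lemma delta_module:
  assumes asym: "\<And>u v. E u v \<Longrightarrow> \<not> E v u"
    and delta: "E x y" "E x y'" "E y y'" "E y z" "E y z'" "E y' z" "E y' z'" "E z z'" "E z x" "E z' x"
    and hom: "\<And>u s t. \<lbrakk>u \<notin> H; s \<in> H; t \<in> H; E s u\<rbrakk> \<Longrightarrow> E t u"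
  shows "{x, y, y', z, z'} \<subseteq> H \<or> {x, y, y', z, z'} \<inter> H \<subseteq> {x} \<or>
    {x, y, y', z, z'} \<inter> H \<subseteq> {y, y'} \<or> {x, y, y', z, z'} \<inter> H \<subseteq> {z, z'}"
proof -
  let ?K = "{x, y, y', z, z'}"
  have inH: "w \<in> H" if "E s w" "E w t" "s \<in> H" "t \<in> H" for s t w
  proof (rule ccontr)
    assume "w \<notin> H"
    then have "E t w"
      using that(3,4,1) by (rule hom)
    then show False
      using asym[of t w] that(2) by simp
  qed
  have "x \<in> H \<and> (y \<in> H \<or> y' \<in> H) \<longrightarrow> z \<in> H \<and> z' \<in> H"
    using inH[OF delta(4,9)] inH[OF delta(5,10)] inH[OF delta(6,9)] inH[OF delta(7,10)] by argo
  moreover have "x \<in> H \<and> (z \<in> H \<or> z' \<in> H) \<longrightarrow> y \<in> H \<and> y' \<in> H"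
    using inH[OF delta(1,4)] inH[OF delta(2,6)] inH[OF delta(1,5)] inH[OF delta(2,7)] by argo
  moreover have "(y \<in> H \<or> y' \<in> H) \<and> (z \<in> H \<or> z' \<in> H) \<longrightarrow> x \<in> H"
    using inH[OF delta(9,1)] inH[OF delta(10,1)] inH[OF delta(9,2)] inH[OF delta(10,2)] by argo
  moreover have "?K \<subseteq> H \<longleftrightarrow> x \<in> H \<and> y \<in> H \<and> y' \<in> H \<and> z \<in> H \<and> z' \<in> H"
    by simp
  moreover have "y \<notin> H \<and> y' \<notin> H \<and> z \<notin> H \<and> z' \<notin> H \<longrightarrow> ?K \<inter> H \<subseteq> {x}"
    "x \<notin> H \<and> z \<notin> H \<and> z' \<notin> H \<longrightarrow> ?K \<inter> H \<subseteq> {y, y'}"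
    "x \<notin> H \<and> y \<notin> H \<and> y' \<notin> H \<longrightarrow> ?K \<inter> H \<subseteq> {z, z'}"
    by auto
  ultimately show ?thesis
    by argo
qed

text \<open>All arcs between \<open>A\<close> and \<open>B\<close> now point from \<open>A\<close>
  to \<open>B\<close>. Confinement to \<open>V\<close> guarantees that the ends of every new arc are
  vertices of the tournament.\<close>

definition forward :: "'a set \<Rightarrow> 'a set \<Rightarrow> 'a set \<Rightarrow> ('a \<Rightarrow> 'a \<Rightarrow> bool) \<Rightarrow> 'a \<Rightarrow> 'a \<Rightarrow> bool" where
  "forward V A B E x y \<longleftrightarrow> x \<in> V \<and> y \<in> V \<and> (x \<in> A \<and> y \<in> B \<or> E x y \<and> \<not> (x \<in> B \<and> y \<in> A))"

locale P6_tournament = rel_tournament V E for V :: "'a set" and E +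
  fixes a1 a2 a3 b1 b2 b3 and A B F
  assumes df: "delta_free E"
    and P6: "P6 E a1 a2 a3 b1 b2 b3"
    and sub: "{a1, a2, a3, b1, b2, b3} \<subseteq> V"
    and no_P7: "\<not> (\<exists>h. P7_embedding E h)"
  defines "A \<equiv> {a1, a2, a3}" and "B \<equiv> {b1, b2, b3}" and "F \<equiv> forward V A B E"
begin

lemma AB: "A \<subseteq> V" "B \<subseteq> V" "A \<inter> B = {}"
proof -
  have "a1 \<noteq> b1" "a1 \<noteq> b2" "a1 \<noteq> b3" "a2 \<noteq> b1" "a2 \<noteq> b2" "a2 \<noteq> b3" "a3 \<noteq> b1" "a3 \<noteq> b2" "a3 \<noteq> b3"
    using P6 irrefl unfolding P6_def by blast+
  then show "A \<subseteq> V" "B \<subseteq> V" "A \<inter> B = {}"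
    using sub unfolding A_def B_def by auto
qed

lemma distinct: "a1 \<noteq> a2" "a2 \<noteq> a3" "a3 \<noteq> a1" "b1 \<noteq> b2" "b2 \<noteq> b3" "b3 \<noteq> b1"
  using P6 irrefl unfolding P6_def by blast+

lemma card_AB: "card A = 3" "card B = 3"
  using distinct unfolding A_def B_def by auto

lemma E_modules:
  assumes "v \<in> V - (A \<union> B)" "s \<in> A \<and> t \<in> A \<or> s \<in> B \<and> t \<in> B"
  shows "E v s \<longleftrightarrow> E v t" and "E s v \<longleftrightarrow> E t v"
  using P6_modules[OF df P6 sub, of v s t] assms unfolding A_def B_def by blast+

text \<open>By the module property \<open>v\<close> would be dominated by all of \<open>B\<close>
  and dominate all of \<open>A\<close>, completing a \<open>P7\<close>.\<close>

lemma no_B_to_A_path: "\<lbrakk>v \<in> V - (A \<union> B); a \<in> A; b \<in> B; E b v; E v a\<rbrakk> \<Longrightarrow> False"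
  using P7_embeddingI[OF P6, of v] no_P7 E_modules[of v] unfolding A_def B_def by blast

lemma F_iff:
  "F x y \<longleftrightarrow> x \<in> V \<and> y \<in> V \<and> (x \<in> A \<and> y \<in> B \<or> E x y \<and> \<not> (x \<in> B \<and> y \<in> A))"
  unfolding F_def forward_def ..

lemma F_tournament: "rel_tournament V F"
proof
  show "finite V"
    by (rule fin)
  show "\<not> F v u" if "F u v" for u v
    using that AB(3) asym[of u v] unfolding F_iff by blast
  show "F u v \<or> F v u" if "u \<in> V" "v \<in> V" "u \<noteq> v" for u v
    using that total[of u v] unfolding F_iff by blast
qed

text \<open>With the matching reversed, \<open>A\<close> and \<open>B\<close> are uniform towards
  each other too and so become modules.\<close>

lemma F_module:
  assumes "H = A \<or> H = B" "u \<notin> H" "s \<in> H" "t \<in> H" "F s u"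
  shows "F t u"
  using assms E_modules(2)[of u s t] AB unfolding F_iff by blast

text \<open>
  \<open>F\<close> and \<open>E\<close> differ only on the matching between \<open>A\<close> and \<open>B\<close>. A single vertex of \<open>A\<close> can be
  exchanged for one that is not matched into \<open>K\<close>.
\<close>

lemma F_lift:
  assumes "K \<inter> A \<subseteq> {a} \<and> \<not> B \<subseteq> K \<or> K \<inter> B \<subseteq> {a} \<and> \<not> A \<subseteq> K"
  shows "\<exists>r. \<forall>u\<in>K. \<forall>v\<in>K. F u v \<longrightarrow> E (r u) (r v)"
proof -
  consider "K \<inter> A \<subseteq> {a}" "\<not> B \<subseteq> K" | "K \<inter> B \<subseteq> {a}" "\<not> A \<subseteq> K"
    using assms by blast
  then show ?thesis
  proof cases
    case 1
    then obtain c where c: "c \<in> A" "\<forall>v\<in>K \<inter> B. E c v"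
      using P6 unfolding A_def B_def P6_def by blast
    have "E (if u \<in> A then c else u) (if v \<in> A then c else v)" if "u \<in> K" "v \<in> K" "F u v" for u v
    proof (cases "u \<in> A"; cases "v \<in> A")
      assume "u \<in> A" "v \<in> A"
      then have "u = v"
        using 1(1) that by blast
      then show ?thesis
        using that \<open>u \<in> A\<close> AB(3) irrefl unfolding F_iff by blast
    next
      assume uv: "u \<in> A" "v \<notin> A"
      then have "E c v"
        using c that E_modules(2)[of v u c] unfolding F_iff by blast
      then show ?thesis using uv by simp
    next
      assume uv: "u \<notin> A" "v \<in> A"
      then have "E u c"
        using c that E_modules(1)[of u v c] unfolding F_iff by blast
      then show ?thesis using uv by simp
    next
      assume uv: "u \<notin> A" "v \<notin> A"
      then show ?thesis
        using that unfolding F_iff by simp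
    qed
    then show ?thesis
      by (intro exI[of _ "\<lambda>u. if u \<in> A then c else u"]) blast
  next
    case 2
    then obtain c where c: "c \<in> B" "\<forall>v\<in>K \<inter> A. E v c"
      using P6 unfolding A_def B_def P6_def by blast
    have "E (if u \<in> B then c else u) (if v \<in> B then c else v)" if "u \<in> K" "v \<in> K" "F u v" for u v
    proof (cases "u \<in> B"; cases "v \<in> B")
      assume "u \<in> B" "v \<in> B"
      then have "u = v"
        using 2(1) that by blast
      then show ?thesis
        using that \<open>u \<in> B\<close> AB(3) irrefl unfolding F_iff by blast
    next
      assume uv: "u \<in> B" "v \<notin> B"
      then have "E c v"
        using c that E_modules(2)[of v u c] unfolding F_iff by blast
      then show ?thesis using uv by simp
    next
      assume uv: "u \<notin> B" "v \<in> B"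
      then have "E u c"
        using c that E_modules(1)[of u v c] unfolding F_iff by blast
      then show ?thesis using uv by simp
    next
      assume uv: "u \<notin> B" "v \<notin> B"
      then show ?thesis
        using that unfolding F_iff by simp
    qed
    then show ?thesis
      by (intro exI[of _ "\<lambda>u. if u \<in> B then c else u"]) blast
  qed
qed

text \<open>As modules of size 3, \<open>A\<close> and \<open>B\<close> each meet a copy
  \<open>K\<close> of \<Delta>(1,2,2) within a single part, hence neither is contained in
  \<open>K\<close>. If one of them meets \<open>K\<close> in at most one vertex,
  \<open>F_lift\<close> carries \<open>K\<close> back to \<open>E\<close>. Otherwise
  \<open>A\<close> and \<open>B\<close> take up the two pairs, and \<open>x\<close> lies on a path
  from \<open>B\<close> to \<open>A\<close>.\<close>

lemma F_delta_free: "delta_free F"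
  unfolding delta_free_def
proof (intro allI notI; elim conjE)
  fix x y y' z z'
  assume F: "F x y" "F x y'" "F y y'" "F y z" "F y z'" "F y' z" "F y' z'" "F z z'" "F z x" "F z' x"
  interpret F: rel_tournament V F
    by (rule F_tournament)
  let ?K = "{x, y, y', z, z'}"
  have neq: "u \<noteq> v" if "F u v" for u v
    using that F.irrefl by blast
  note ne = F[THEN neq]
  have small: "?K \<inter> H \<subseteq> {x} \<or> ?K \<inter> H \<subseteq> {y, y'} \<or> ?K \<inter> H \<subseteq> {z, z'}" if "H = A \<or> H = B" for H
  proof -
    have "\<not> ?K \<subseteq> H"
    proof
      assume "?K \<subseteq> H"
      then have "card ?K \<le> card H"
        using that by (intro card_mono) (auto simp: A_def B_def)
      moreover have "card H = 3"
        using that card_AB by blast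
      moreover have "card ?K = 5"
        using ne ne[symmetric] by simp
      ultimately show False by simp
    qed
    moreover have "?K \<subseteq> H \<or> ?K \<inter> H \<subseteq> {x} \<or> ?K \<inter> H \<subseteq> {y, y'} \<or> ?K \<inter> H \<subseteq> {z, z'}"
    proof (rule delta_module[OF _ F])
      show "\<not> F v u" if "F u v" for u v
        using that by (rule F.asym)
      show "F t u" if "u \<notin> H" "s \<in> H" "t \<in> H" "F s u" for u s t
        using \<open>H = A \<or> H = B\<close> that by (rule F_module)
    qed
    ultimately show ?thesis
      by argo
  qed
  have "\<not> H \<subseteq> ?K" if H: "H = A \<or> H = B" for H
  proof
    assume "H \<subseteq> ?K"
    then have "?K \<inter> H = H"
      by blast
    then have "H \<subseteq> {x, x} \<or> H \<subseteq> {y, y'} \<or> H \<subseteq> {z, z'}"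
      using small[OF H] by simp
    then obtain p q where "H \<subseteq> {p, q}"
      by blast
    then have "card H \<le> card {p, q}"
      by (intro card_mono) auto
    also have "\<dots> \<le> 2"
      by (simp add: card_insert_if)
    finally show False
      using H card_AB by auto
  qed
  then have AK: "\<not> A \<subseteq> ?K" and BK: "\<not> B \<subseteq> ?K"
    by simp_all
  show False
  proof (cases "\<exists>c. ?K \<inter> A \<subseteq> {c} \<or> ?K \<inter> B \<subseteq> {c}")
    case True
    then obtain c where "?K \<inter> A \<subseteq> {c} \<or> ?K \<inter> B \<subseteq> {c}"
      by (rule exE)
    then have "?K \<inter> A \<subseteq> {c} \<and> \<not> B \<subseteq> ?K \<or> ?K \<inter> B \<subseteq> {c} \<and> \<not> A \<subseteq> ?K"
      using AK BK by argo
    then have "\<exists>r. \<forall>u\<in>?K. \<forall>v\<in>?K. F u v \<longrightarrow> E (r u) (r v)"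
      by (rule F_lift)
    then obtain r where "\<forall>u\<in>?K. \<forall>v\<in>?K. F u v \<longrightarrow> E (r u) (r v)"
      by (rule exE)
    then show False
      by (intro delta_freeD[OF df, of "r x" "r y" "r y'" "r z" "r z'"]) (simp_all add: F)
  next
    case False
    then have c: "\<not> ?K \<inter> A \<subseteq> {c}" "\<not> ?K \<inter> B \<subseteq> {c}" for c
      by blast+
    have pair: "p \<in> S \<and> q \<in> S" if "T \<inter> S \<subseteq> {p, q}" "\<And>c. \<not> T \<inter> S \<subseteq> {c}" for p q :: 'a and S T
      using that(1) that(2)[of p] that(2)[of q] by blast
    have A: "?K \<inter> A \<subseteq> {y, y'} \<and> y \<in> A \<or> ?K \<inter> A \<subseteq> {z, z'} \<and> z \<in> A"
      using small[of A] c(1)[of x] pair[of ?K A y y', OF _ c(1)] pair[of ?K A z z', OF _ c(1)] by metis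
    have B: "?K \<inter> B \<subseteq> {y, y'} \<and> y \<in> B \<or> ?K \<inter> B \<subseteq> {z, z'} \<and> z \<in> B"
      using small[of B] c(2)[of x] pair[of ?K B y y', OF _ c(2)] pair[of ?K B z z', OF _ c(2)] by metis
    have x: "x \<notin> S" if "?K \<inter> S \<subseteq> {y, y'} \<or> ?K \<inter> S \<subseteq> {z, z'}" for S
    proof
      assume "x \<in> S"
      then have "x \<in> ?K \<inter> S"
        by simp
      then have "x \<in> {y, y'} \<or> x \<in> {z, z'}"
        using that by (meson subsetD)
      then show False
        using ne(1,2,9,10) by simp
    qed
    have xA: "x \<notin> A" and xB: "x \<notin> B"
      using A B x[of A] x[of B] by argo+
    have "y \<in> A \<or> z \<in> A" "y \<in> B \<or> z \<in> B"
      using A B by argo+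
    then have yz: "y \<in> A \<and> z \<in> B \<or> y \<in> B \<and> z \<in> A"
      using AB(3) by blast
    \<comment> \<open>\<open>F\<close> has no arcs from \<open>B\<close> to \<open>A\<close>, so the
      arc from \<open>y\<close> to \<open>z\<close> decides which pair lies where.\<close>
    then have "y \<in> A \<and> z \<in> B"
      using F(4) yz AB(3) unfolding F_iff by blast
    then show False
      using no_B_to_A_path[of x y z] F(1,9) xA xB AB(3) unfolding F_iff by blast
  qed
qed

text \<open>\<open>P7\<close> is prime and has more than three vertices, so it meets each of the
  modules \<open>A\<close> and \<open>B\<close> at most once and lifts to a \<open>P7\<close> of
  \<open>E\<close>.\<close>

lemma F_no_P7: "\<not> P7_embedding F h"
proof
  assume h: "P7_embedding F h"
  interpret F: rel_tournament V F
    by (rule F_tournament)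
  note arc = P7_embedding_arc[OF h]
  have two: "\<exists>s\<in>S. \<exists>t\<in>S. s \<noteq> t" if "\<not> (\<exists>c. S \<subseteq> {c})" for S :: "'a set"
  proof -
    have "S \<noteq> {}"
      using that by auto
    then obtain s where "s \<in> S"
      by blast
    moreover have "\<not> S \<subseteq> {s}"
      using that by simp
    ultimately show ?thesis
      by blast
  qed
  have small: "\<exists>c. range h \<inter> H \<subseteq> {c}" if "H = A \<or> H = B" for H
  proof (rule ccontr)
    assume "\<not> ?thesis"
    then have "\<exists>s\<in>range h \<inter> H. \<exists>t\<in>range h \<inter> H. s \<noteq> t"
      by (rule two)
    then obtain i j where "h i \<in> H" "h j \<in> H" "h i \<noteq> h j"
      by auto
    then have "range h \<subseteq> H"
    proof (intro P7_prime[OF h])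
      show "\<not> F v u" if "F u v" for u v
        using that by (rule F.asym)
      show "F t u" if "u \<notin> H" "s \<in> H" "t \<in> H" "F s u" for u s t
        using \<open>H = A \<or> H = B\<close> that by (rule F_module)
    qed
    then have "{h 0, h 1, h 2, h 3} \<subseteq> H"
      by blast
    then have "card {h 0, h 1, h 2, h 3} \<le> card H"
      using that by (intro card_mono) (auto simp: A_def B_def)
    moreover have "card H = 3"
      using that card_AB by blast
    moreover have "F (h 0) (h 1)" "F (h 0) (h 2)" "F (h 1) (h 2)" "F (h 1) (h 3)" "F (h 2) (h 3)" "F (h 3) (h 0)"
      by (simp_all add: arc)
    then have "h 0 \<noteq> h 1" "h 0 \<noteq> h 2" "h 1 \<noteq> h 2" "h 1 \<noteq> h 3" "h 2 \<noteq> h 3" "h 3 \<noteq> h 0"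
      using F.irrefl by metis+
    then have "card {h 0, h 1, h 2, h 3} = 4"
      by (simp add: card_insert_if)
    ultimately show False by simp
  qed
  obtain a where "range h \<inter> A \<subseteq> {a}"
    using small[of A] by auto
  moreover obtain b where b: "range h \<inter> B \<subseteq> {b}"
    using small[of B] by auto
  moreover have "\<not> B \<subseteq> range h"
  proof
    assume "B \<subseteq> range h"
    with b have "B \<subseteq> {b}"
      by auto
    then show False
      using distinct unfolding B_def by auto
  qed
  ultimately have "range h \<inter> A \<subseteq> {a} \<and> \<not> B \<subseteq> range h \<or> range h \<inter> B \<subseteq> {a} \<and> \<not> A \<subseteq> range h"
    by argo
  then have "\<exists>r. \<forall>u\<in>range h. \<forall>v\<in>range h. F u v \<longrightarrow> E (r u) (r v)"
    by (rule F_lift)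
  then obtain r where "\<forall>u\<in>range h. \<forall>v\<in>range h. F u v \<longrightarrow> E (r u) (r v)"
    by (rule exE)
  then have "P7_embedding E (r \<circ> h)"
    using h unfolding P7_embedding_def by simp
  with no_P7 show False by blast
qed

text \<open>Only arcs from \<open>A\<close> to \<open>B\<close> can be new. A third vertex closing a
  triangle over such an arc cannot lie in \<open>A\<close> or \<open>B\<close>, as \<open>F\<close>
  has no arcs from \<open>B\<close> to \<open>A\<close>, nor outside, by
  \<open>no_B_to_A_path\<close>.\<close>

lemma F_triangle_E:
  assumes "F x y" "F y z" "F z x"
  shows "E x y"
  using assms no_B_to_A_path[of z x y] AB unfolding F_iff by blast

lemma cyclic_triples_F: "card (cyclic_triples V F) < card (cyclic_triples V E)"
proof (rule psubset_card_mono[OF finite_cyclic_triples[OF fin]])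
  have "cyclic_triples V F \<subseteq> cyclic_triples V E"
    unfolding cyclic_triples_def using F_triangle_E by blast
  moreover have "(b1, a1, a2) \<in> cyclic_triples V E"
    using P6 sub unfolding cyclic_triples_def P6_def by simp
  moreover have "(b1, a1, a2) \<notin> cyclic_triples V F"
    using AB(3) unfolding cyclic_triples_def F_iff A_def B_def by auto
  ultimately show "cyclic_triples V F \<subset> cyclic_triples V E"
    by blast
qed

text \<open>The classes \<open>{a1, a2, b3}\<close> and \<open>{a3, b2, b1}\<close> are transitive
  in \<open>E\<close> and separate the two ends of every matching arc.\<close>

lemma two_colouring_of_F:
  fixes f :: "'a \<Rightarrow> bool"
  assumes f: "proper V F f"
  shows "proper V E (\<lambda>v. if v \<in> A \<union> B then v \<in> {a1, a2, b3} else f v)"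
proof (rule proper_patch)
  have tri: False if "F x y" "F y z" "F z x" "f x = f y" "f y = f z" for x y z
  proof -
    have "x \<in> V" "y \<in> V" "z \<in> V"
      using that(1-3) unfolding F_iff by simp_all
    then show False
      using f that unfolding proper_def by blast
  qed
  show False
    if "x \<in> V - (A \<union> B)" "y \<in> V - (A \<union> B)" "z \<in> V - (A \<union> B)" "E x y" "E y z" "E z x"
      "f x = f y" "f y = f z" for x y z
    by (rule tri[of x y z]) (use that in \<open>simp_all add: F_iff\<close>)
  show False
    if uv: "s \<in> A \<union> B" "u \<in> V - (A \<union> B)" "v \<in> V - (A \<union> B)" "E s u" "E u v" "E v s"
      "(s \<in> {a1, a2, b3}) = f u" "f u = f v" for s u v
  proof -
    \<comment> \<open>All vertices of the part containing \<open>s\<close> form cyclic triangles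
      with \<open>u\<close> and \<open>v\<close>, so \<open>f\<close> gives each the other colour;
      but that part is itself a cyclic triangle of \<open>F\<close>.\<close>
    have ne: "f t \<noteq> f u" if st: "s \<in> A \<and> t \<in> A \<or> s \<in> B \<and> t \<in> B" for t
    proof
      assume "f t = f u"
      have "E t u" "E v t"
        using uv(4,6) E_modules(2)[OF uv(2) st] E_modules(1)[OF uv(3) st] by blast+
      then have "F t u" "F u v" "F v t"
        using st uv(2,3,5) AB(1,2) unfolding F_iff by blast+
      then show False
        using tri \<open>f t = f u\<close> uv(8) by blast
    qed
    have F: "F a1 a2" "F a2 a3" "F a3 a1" "F b1 b3" "F b3 b2" "F b2 b1"
      using P6 AB unfolding P6_def F_iff A_def B_def by auto
    show False
    proof (cases "s \<in> A")
      case True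
      then have "f a1 \<noteq> f u" "f a2 \<noteq> f u" "f a3 \<noteq> f u"
        using ne unfolding A_def by simp_all
      then show False
        using tri[OF F(1-3)] by argo
    next
      case False
      then have "f b1 \<noteq> f u" "f b2 \<noteq> f u" "f b3 \<noteq> f u"
        using ne uv(1) unfolding B_def by simp_all
      then show False
        using tri[OF F(4-6)] by argo
    qed
  qed
  have out: "b1 \<notin> {a1, a2, b3}" "b2 \<notin> {a1, a2, b3}" "a3 \<notin> {a1, a2, b3}"
    using AB(3) distinct unfolding A_def B_def by auto
  show False
    if st: "s \<in> A \<union> B" "t \<in> A \<union> B" "v \<in> V - (A \<union> B)" "E s t" "E t v" "E v s"
      "(s \<in> {a1, a2, b3}) = (t \<in> {a1, a2, b3})" for s t v
  proof -
    \<comment> \<open>The vertices \<open>s\<close> and \<open>t\<close> lie in different parts by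
      the module property; \<open>no_B_to_A_path\<close> fixes the direction, so the arc belongs to
      the matching, whose ends differ in colour.\<close>
    have "s \<in> B" "t \<in> A"
      using E_modules(1)[OF st(3), of s t] asym[OF st(5)] st(1,2,6) no_B_to_A_path[OF st(3) _ _ st(5,6)]
      by blast+
    moreover have "\<not> E b1 a2" "\<not> E b1 a3" "\<not> E b2 a1" "\<not> E b2 a3" "\<not> E b3 a1" "\<not> E b3 a2"
      using P6 asym unfolding P6_def by auto
    ultimately have "s = b1 \<and> t = a1 \<or> s = b2 \<and> t = a2 \<or> s = b3 \<and> t = a3"
      using st(4) unfolding A_def B_def by auto
    then show False
      using out st(7) by auto
  qed
  show False
    if "x \<in> A \<union> B" "y \<in> A \<union> B" "z \<in> A \<union> B" "E x y" "E y z" "E z x"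
      "(x \<in> {a1, a2, b3}) = (y \<in> {a1, a2, b3})" "(y \<in> {a1, a2, b3}) = (z \<in> {a1, a2, b3})" for x y z
  proof -
    have "A \<union> B = {a1, a2, b3} \<union> {a3, b2, b1}"
      unfolding A_def B_def by auto
    then have "x \<in> {a1, a2, b3} \<and> y \<in> {a1, a2, b3} \<and> z \<in> {a1, a2, b3} \<or>
        x \<in> {a3, b2, b1} \<and> y \<in> {a3, b2, b1} \<and> z \<in> {a3, b2, b1}"
      using that by blast
    then show False
      using transitive_triple[of a1 a2 b3 x y z] transitive_triple[of a3 b2 b1 x y z] that(4-6) P6
      unfolding P6_def by blast
  qed
qed

end

subsection \<open>Two-colouring\<close>

lemma rel_tournament_subset: "rel_tournament V E \<Longrightarrow> U \<subseteq> V \<Longrightarrow> rel_tournament U E"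
  unfolding rel_tournament_def using finite_subset by blast

text \<open>Every cyclic triangle through \<open>v\<close> uses an in-neighbour of \<open>v\<close>,
  so it is enough that \<open>v\<close> differs in colour from its only one.\<close>

lemma (in rel_tournament) two_colouring_insert:
  fixes f :: "'a \<Rightarrow> bool"
  assumes f: "proper (V - {v}) E f" and "card {u \<in> V. E u v} < 2"
  shows "\<exists>f :: 'a \<Rightarrow> bool. proper V E f"
proof -
  have "finite {u \<in> V. E u v}" "card {u \<in> V. E u v} \<le> Suc 0"
    using assms(2) fin by simp_all
  then have eq: "u = w" if "u \<in> V" "E u v" "w \<in> V" "E w v" for u w
    using that by (simp add: card_le_Suc0_iff_eq)
  \<comment> \<open>Without an in-neighbour of \<open>v\<close>, \<open>w\<close> is
    arbitrary.\<close>
  obtain w where w: "u = w" if "u \<in> V" "E u v" for u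
    using eq by metis
  have "proper V E (\<lambda>u. if u \<in> {v} then \<not> f w else f u)"
  proof (rule proper_patch)
    show False if "x \<in> V - {v}" "y \<in> V - {v}" "z \<in> V - {v}" "E x y" "E y z" "E z x"
      "f x = f y" "f y = f z" for x y z
      using f that unfolding proper_def by blast
    show False if "s \<in> {v}" "a \<in> V - {v}" "b \<in> V - {v}" "E s a" "E a b" "E b s"
      "(\<not> f w) = f a" "f a = f b" for s a b
      using that w[of b] by auto
  qed (use irrefl in auto)
  then show ?thesis
    by blast
qed

text \<open>The vertices \<open>a\<close>, \<open>b\<close>, \<open>d\<close> that remain form a
  cyclic triangle, so \<open>f\<close> uses both colours on it. By the module property no
  monochromatic pair outside can then close a triangle with a vertex of the \<open>T5\<close>,
  whatever colours its vertices receive.\<close>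

lemma (in rel_tournament) two_colouring_T5:
  fixes f :: "'a \<Rightarrow> bool"
  assumes df: "delta_free E" and T5: "T5 E a b c d e" and sub: "{a, b, c, d, e} \<subseteq> V"
    and f: "proper (V - {c, e}) E f"
  shows "proper V E (\<lambda>v. if v \<in> {a, b, c, d, e} then v \<in> {a, b, c} else f v)"
proof (rule proper_patch)
  let ?S = "{a, b, c, d, e}"
  have ne: "a \<noteq> b" "a \<noteq> c" "a \<noteq> d" "a \<noteq> e" "b \<noteq> c" "b \<noteq> d" "b \<noteq> e" "c \<noteq> d" "c \<noteq> e" "d \<noteq> e"
    using T5 irrefl unfolding T5_def by blast+
  have tri: False if "x \<in> V - {c, e}" "y \<in> V - {c, e}" "z \<in> V - {c, e}" "E x y" "E y z" "E z x"
    "f x = f y" "f y = f z" for x y z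
    using f that unfolding proper_def by blast
  show False if "x \<in> V - ?S" "y \<in> V - ?S" "z \<in> V - ?S" "E x y" "E y z" "E z x"
      "f x = f y" "f y = f z" for x y z
    by (rule tri[of x y z]) (use that in simp_all)
  show False if uv: "s \<in> ?S" "u \<in> V - ?S" "v \<in> V - ?S" "E s u" "E u v" "E v s"
      "(s \<in> {a, b, c}) = f u" "f u = f v" for s u v
  proof -
    have abd: "t \<in> ?S" "t \<in> V - {c, e}" if "t \<in> {a, b, d}" for t
      using that sub ne by auto
    have ne: "f t \<noteq> f u" if t: "t \<in> {a, b, d}" for t
    proof
      assume "f t = f u"
      moreover have "E t u" "E v t"
        using uv(4,6) T5_module(1)[OF df T5 sub uv(2,1) abd(1)[OF t]]
          T5_module(2)[OF df T5 sub uv(3,1) abd(1)[OF t]] by blast+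
      ultimately show False
        using tri[of t u v] abd(2)[OF t] uv(2,3,5,8) by auto
    qed
    moreover have "E a b" "E b d" "E d a"
      using T5 unfolding T5_def by blast+
    ultimately show False
      using tri[of a b d] abd(2)[of a] abd(2)[of b] abd(2)[of d] ne[of a] ne[of b] ne[of d] by auto
  qed
  show False if st: "s \<in> ?S" "t \<in> ?S" "v \<in> V - ?S" "E s t" "E t v" "E v s" for s t v
    using T5_module(1)[OF df T5 sub st(3,1,2)] st(5,6) asym by blast
  show False if xyz: "x \<in> ?S" "y \<in> ?S" "z \<in> ?S" "E x y" "E y z" "E z x"
      "(x \<in> {a, b, c}) = (y \<in> {a, b, c})" "(y \<in> {a, b, c}) = (z \<in> {a, b, c})" for x y z
  proof -
    have "x \<in> {a, b, c} \<and> y \<in> {a, b, c} \<and> z \<in> {a, b, c} \<or> x \<in> {d, e, e} \<and> y \<in> {d, e, e} \<and> z \<in> {d, e, e}"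
      using xyz by blast
    moreover have "E a b" "E b c" "E a c" "E d e" "\<not> E e d"
      using T5 asym unfolding T5_def by blast+
    ultimately show False
      using transitive_triple[of a b c x y z] xyz(4-6) irrefl by auto
  qed
qed

text \<open>Deleting vertices lowers the first summand of the measure without raising the second;
  reversing a matching keeps \<open>V\<close> and lowers the second.\<close>

theorem two_colouring_or_P7:
  assumes "rel_tournament V E" "delta_free E"
  shows "(\<exists>f :: 'a \<Rightarrow> bool. proper V E f) \<or> (\<exists>h. P7_embedding E h)"
  using assms
proof (induction "card V + card (cyclic_triples V E)" arbitrary: V E rule: less_induct)
  case (less V E)
  interpret rel_tournament V E
    by (rule less.prems(1))
  note df = less.prems(2)
  have IH: "\<exists>f :: 'a \<Rightarrow> bool. proper U E f" if "U \<subset> V" "\<not> (\<exists>h. P7_embedding E h)" for U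
  proof -
    have "card (cyclic_triples U E) \<le> card (cyclic_triples V E)"
      using that fin by (intro card_mono finite_cyclic_triples cyclic_triples_mono) auto
    moreover have "card U < card V"
      using that fin by (intro psubset_card_mono)
    ultimately have "card U + card (cyclic_triples U E) < card V + card (cyclic_triples V E)"
      by simp
    moreover have "rel_tournament U E"
      using rel_tournament_subset[OF less.prems(1)] that(1) by blast
    ultimately have "(\<exists>f :: 'a \<Rightarrow> bool. proper U E f) \<or> (\<exists>h. P7_embedding E h)"
      using df by (rule less.hyps)
    with that(2) show ?thesis
      by argo
  qed
  show ?case
  proof (rule ccontr)
    assume neg: "\<not> ?case"
    then have no_P7: "\<not> (\<exists>h. P7_embedding E h)"
      by (rule contrapos_nn) (rule disjI2)
    have no_col: "\<not> proper V E f" for f :: "'a \<Rightarrow> bool"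
      using neg by (rule contrapos_nn) (intro disjI1 exI)
    have "V \<noteq> {}"
    proof
      assume "V = {}"
      then have "proper V E (\<lambda>_. True)"
        unfolding proper_def by simp
      with no_col show False
        by (rule notE)
    qed
    moreover have "2 \<le> card {u \<in> V. E u v}" if "v \<in> V" for v
    proof (rule ccontr)
      assume "\<not> ?thesis"
      then have "card {u \<in> V. E u v} < 2"
        by simp
      moreover have "V - {v} \<subset> V"
        using that by auto
      then obtain f :: "'a \<Rightarrow> bool" where "proper (V - {v}) E f"
        using IH no_P7 by blast
      ultimately have "\<exists>f :: 'a \<Rightarrow> bool. proper V E f"
        by (intro two_colouring_insert)
      then show False
        using no_col by blast
    qed
    ultimately have "(\<exists>a b c d e. {a, b, c, d, e} \<subseteq> V \<and> T5 E a b c d e) \<or>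
        (\<exists>a1 a2 a3 b1 b2 b3. {a1, a2, a3, b1, b2, b3} \<subseteq> V \<and> P6 E a1 a2 a3 b1 b2 b3)"
      by (rule T5_or_P6[OF _ _ df])
    then show False
    proof (elim disjE exE conjE)
      fix a b c d e
      assume 1: "{a, b, c, d, e} \<subseteq> V" "T5 E a b c d e"
      then have "V - {c, e} \<subset> V"
        by auto
      then obtain f :: "'a \<Rightarrow> bool" where "proper (V - {c, e}) E f"
        using IH no_P7 by blast
      then have "proper V E (\<lambda>v. if v \<in> {a, b, c, d, e} then v \<in> {a, b, c} else f v)"
        by (rule two_colouring_T5[OF df 1(2,1)])
      with no_col show False
        by (rule notE)
    next
      fix a1 a2 a3 b1 b2 b3
      assume 2: "{a1, a2, a3, b1, b2, b3} \<subseteq> V" "P6 E a1 a2 a3 b1 b2 b3"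
      let ?F = "forward V {a1, a2, a3} {b1, b2, b3} E"
      interpret P6: P6_tournament V E a1 a2 a3 b1 b2 b3 "{a1, a2, a3}" "{b1, b2, b3}" ?F
        using 2 df no_P7 by unfold_locales
      have "card V + card (cyclic_triples V ?F) < card V + card (cyclic_triples V E)"
        using P6.cyclic_triples_F by simp
      then have "(\<exists>f :: 'a \<Rightarrow> bool. proper V ?F f) \<or> (\<exists>h. P7_embedding ?F h)"
        using P6.F_tournament P6.F_delta_free by (rule less.hyps)
      then obtain f :: "'a \<Rightarrow> bool" where "proper V ?F f"
        using P6.F_no_P7 by blast
      from no_col P6.two_colouring_of_F[OF this] show False
        by (rule notE)
    qed
  qed
qed

lemma P7_not_two_colourable:
  fixes f :: "'a \<Rightarrow> bool"
  assumes h: "P7_embedding E h" and "range h \<subseteq> V"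
  shows "\<not> proper V E f"
proof
  assume f: "proper V E f"
  \<comment> \<open>These seven triangles are the lines of the Fano plane, which has no proper
    2-colouring.\<close>
  have "\<not> (f (h i) = f (h (i + 1)) \<and> f (h (i + 1)) = f (h (i + 3)))" for i
  proof -
    have "E (h i) (h (i + 1))" "E (h (i + 1)) (h (i + 3))" "E (h (i + 3)) (h i)"
      by (simp_all add: P7_embedding_arc[OF h])
    then show ?thesis
      using f assms(2) unfolding proper_def by blast
  qed
  from this[of 0] this[of 1] this[of 2] this[of 3] this[of 4] this[of 5] this[of 6]
  show False
    using P7_embedding_mod[OF h, of 7 0] P7_embedding_mod[OF h, of 8 1] P7_embedding_mod[OF h, of 9 2]
    by simp argo
qed

subsection \<open>Three-colouring and the translation to digraphs\<close>

lemma (in rel_tournament) delta_free_pairs: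
  assumes "delta_free E" "{y, y', z, z'} \<subseteq> V" "y \<noteq> y'" "z \<noteq> z'"
    and "E x y" "E x y'" "E y z" "E y z'" "E y' z" "E y' z'" "E z x" "E z' x"
  shows False
proof -
  have "E y y' \<or> E y' y" "E z z' \<or> E z' z"
    using total assms(2-4) by simp_all
  then show False
    using delta_freeD[OF assms(1), of x y y' z z'] delta_freeD[OF assms(1), of x y y' z' z]
      delta_freeD[OF assms(1), of x y' y z z'] delta_freeD[OF assms(1), of x y' y z' z] assms(5-12)
    by argo
qed

text \<open>Each copy is a module towards the triangle vertices outside it, so replacing
  \<open>x2\<close> and \<open>x3\<close> by pairs inside their copies blows the triangle up to a
  \<Delta>(1,2,2) with single vertex \<open>x1\<close>.\<close>

lemma (in rel_tournament) P7_cycle: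
  assumes df: "delta_free E" and h: "P7_embedding E h2" "P7_embedding E h3"
    and sub: "range h2 \<subseteq> V" "range h3 \<subseteq> V" "x1 \<in> V"
    and x: "x2 \<in> range h2" "x3 \<in> range h3"
    and out: "x1 \<notin> range h2" "x1 \<notin> range h3" "x2 \<notin> range h3" "x3 \<notin> range h2"
    and cyc: "E x1 x2" "E x2 x3" "E x3 x1"
  shows False
proof -
  have V: "x1 \<in> V - range h2" "x1 \<in> V - range h3" "x2 \<in> V - range h3" "x3 \<in> V - range h2"
    using sub x out by blast+
  have dom: "E x1 u" "E u x3" if "u \<in> range h2" for u
    using P7_module(1)[OF df h(1) sub(1) V(1) that x(1)] P7_module(2)[OF df h(1) sub(1) V(4) that x(1)] cyc
    by simp_all
  have dom': "E x2 u" "E u x1" if "u \<in> range h3" for u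
    using P7_module(1)[OF df h(2) sub(2) V(3) that x(2)] P7_module(2)[OF df h(2) sub(2) V(2) that x(2)] cyc
    by simp_all
  obtain i j where ij: "x2 = h2 i" "x3 = h3 j"
    using x by blast
  have arcs: "E x2 (h2 (i + 1))" "E x2 (h2 (i + 2))" "E (h2 (i + 1)) (h2 (i + 2))" "E x3 (h3 (j + 1))"
    unfolding ij by (simp_all add: P7_embedding_arc[OF h(1)] P7_embedding_arc[OF h(2)])
  \<comment> \<open>The copies may overlap. If two successors of \<open>x2\<close> lie in both, they
    serve as \<open>y\<close> and \<open>z\<close>; otherwise some \<open>y\<close> lies outside
    \<open>range h3\<close> and dominates that whole copy, as it dominates
    \<open>x3\<close>.\<close>
  have "\<exists>y z. y \<in> range h2 \<and> z \<in> range h3 \<and> y \<noteq> x2 \<and> z \<noteq> x3 \<and> E y z"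
  proof (cases "h2 (i + 1) \<in> range h3 \<and> h2 (i + 2) \<in> range h3")
    case True
    then show ?thesis
      using arcs irrefl out(4) by (intro exI[of _ "h2 (i + 1)"] exI[of _ "h2 (i + 2)"]) auto
  next
    case False
    then obtain y where y: "y \<in> range h2" "E x2 y" "y \<notin> range h3"
      using arcs by blast
    have "y \<in> V - range h3"
      using y sub(1) by blast
    then have "E y (h3 (j + 1))"
      using P7_module(1)[OF df h(2) sub(2) _ _ x(2), of y "h3 (j + 1)"] dom(2)[OF y(1)] by blast
    then show ?thesis
      using y arcs(4) irrefl by (intro exI[of _ y] exI[of _ "h3 (j + 1)"]) auto
  qed
  then obtain y z where yz: "y \<in> range h2" "z \<in> range h3" "y \<noteq> x2" "z \<noteq> x3" "E y z"
    by blast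
  show False
    using delta_free_pairs[OF df, of x2 y x3 z x1] yz dom[OF yz(1)] dom'[OF yz(2)] cyc sub x by blast
qed

theorem three_colouring:
  assumes T: "rel_tournament V E" and df: "delta_free E"
    and field: "\<And>u v. E u v \<Longrightarrow> u \<in> V \<and> v \<in> V"
  shows "\<exists>f :: 'a \<Rightarrow> nat. f ` V \<subseteq> {1..3} \<and> proper V E f"
proof -
  interpret rel_tournament V E
    by (rule T)
  define hits where "hits X \<longleftrightarrow> X \<subseteq> V \<and> (\<forall>h. P7_embedding E h \<longrightarrow> range h \<inter> X \<noteq> {})" for X
  have range: "range h \<subseteq> V" if "P7_embedding E h" for h
    using that field unfolding P7_embedding_def by blast
  then have "hits V"
    unfolding hits_def by blast
  then obtain X where X: "hits X" and min: "\<And>Y. hits Y \<Longrightarrow> card X \<le> card Y"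
    using ex_has_least_nat[of hits V card] by blast
  have "finite X"
    using X fin finite_subset unfolding hits_def by blast
  \<comment> \<open>By minimality, dropping \<open>x\<close> leaves some copy unhit.\<close>
  have witness: "\<exists>h. P7_embedding E h \<and> range h \<inter> X = {x}" if "x \<in> X" for x
  proof -
    have "\<not> hits (X - {x})"
      using min[of "X - {x}"] card_Diff1_less[OF \<open>finite X\<close> that] by auto
    then obtain h where h: "P7_embedding E h" "range h \<inter> (X - {x}) = {}"
      using X unfolding hits_def by blast
    moreover have "range h \<inter> X \<noteq> {}"
      using X h(1) unfolding hits_def by blast
    ultimately show ?thesis
      by (intro exI[of _ h]) blast
  qed
  have acyclic: False if x: "x1 \<in> X" "x2 \<in> X" "x3 \<in> X" and cyc: "E x1 x2" "E x2 x3" "E x3 x1" for x1 x2 x3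
  proof -
    obtain h2 where h2: "P7_embedding E h2" "range h2 \<inter> X = {x2}"
      using witness[OF x(2)] by blast
    obtain h3 where h3: "P7_embedding E h3" "range h3 \<inter> X = {x3}"
      using witness[OF x(3)] by blast
    have ne: "x1 \<noteq> x2" "x2 \<noteq> x3" "x3 \<noteq> x1"
      using cyc irrefl by blast+
    have in2: "u \<in> range h2 \<longleftrightarrow> u = x2" if "u \<in> X" for u
      using h2(2) that by auto
    have in3: "u \<in> range h3 \<longleftrightarrow> u = x3" if "u \<in> X" for u
      using h3(2) that by auto
    have "x1 \<in> V"
      using x(1) X unfolding hits_def by blast
    then show False
      by (rule P7_cycle[OF df h2(1) h3(1) range[OF h2(1)] range[OF h3(1)]])
        (use in2 in3 x ne cyc in simp_all)
  qed
  \<comment> \<open>Copies of \<open>P7\<close> are not tied to a vertex set, so the relation itself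
    has to be cut down to the complement of \<open>X\<close>.\<close>
  let ?E = "\<lambda>u v. E u v \<and> u \<notin> X \<and> v \<notin> X"
  have "rel_tournament (V - X) ?E"
    using fin asym total by unfold_locales auto
  moreover have "delta_free ?E"
    using df unfolding delta_free_def by blast
  moreover have "\<not> P7_embedding ?E h" for h
  proof
    assume h: "P7_embedding ?E h"
    then have "P7_embedding E h"
      unfolding P7_embedding_def by blast
    moreover have "range h \<inter> X = {}"
      using h unfolding P7_embedding_def by blast
    ultimately show False
      using X unfolding hits_def by blast
  qed
  ultimately obtain f :: "'a \<Rightarrow> bool" where f: "proper (V - X) ?E f"
    using two_colouring_or_P7 by blast
  let ?c = "\<lambda>v. if v \<in> X then 3 else if f v then 1 else 2 :: nat"
  have "proper V E ?c"
    unfolding proper_def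
  proof (intro ballI impI notI; elim conjE)
    fix x y z
    assume xyz: "x \<in> V" "y \<in> V" "z \<in> V" "E x y" "E y z" "E z x" "?c x = ?c y" "?c y = ?c z"
    have colour: "u \<in> X \<and> v \<in> X \<or> u \<notin> X \<and> v \<notin> X \<and> f u = f v" if "?c u = ?c v" for u v
      using that by (simp split: if_splits)
    from colour[OF xyz(7)] colour[OF xyz(8)]
    consider "x \<in> X" "y \<in> X" "z \<in> X" | "x \<notin> X" "y \<notin> X" "z \<notin> X" "f x = f y" "f y = f z"
      by argo
    then show False
    proof cases
      case 1
      then show ?thesis
        using xyz(4-6) by (rule acyclic)
    next
      case 2
      then show ?thesis
        using f xyz(1-6) unfolding proper_def by blast
    qed
  qed
  moreover have "?c ` V \<subseteq> {1..3}"
    by auto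
  ultimately show ?thesis
    by blast
qed

section \<open>Passing between digraphs and arc relations\<close>

lemma proper_recolour:
  assumes "proper V E f" and "\<And>u v. u \<in> V \<Longrightarrow> v \<in> V \<Longrightarrow> g u = g v \<Longrightarrow> f u = f v"
  shows "proper V E g"
  unfolding proper_def
proof (intro ballI impI notI; elim conjE)
  fix x y z
  assume *: "x \<in> V" "y \<in> V" "z \<in> V" "E x y" "E y z" "E z x" "g x = g y" "g y = g z"
  have "f x = f y" "f y = f z"
    using assms(2)[OF *(1,2,7)] assms(2)[OF *(2,3,8)] .
  with assms(1) *(1-6) show False
    unfolding proper_def by blast
qed

text \<open>Between tournaments an arc-preserving map is injective, as the target has no loops, and
  reflects arcs, so its image is an induced copy.\<close>

lemma tournament_free_iff:
  assumes "tournament S" "tournament T"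
  shows "tournament_free S T \<longleftrightarrow>
    \<not> (\<exists>g. g ` pverts S \<subseteq> pverts T \<and> (\<forall>i j. (i, j) \<in> parcs S \<longrightarrow> (g i, g j) \<in> parcs T))"
proof -
  interpret S: tournament S by fact
  interpret T: tournament T by fact
  have embed: "\<exists>g. g ` pverts S \<subseteq> pverts T \<and> (\<forall>i j. (i, j) \<in> parcs S \<longrightarrow> (g i, g j) \<in> parcs T)"
    if W: "W \<subseteq> pverts T" and iso: "digraph_iso (with_proj T \<restriction> W) (with_proj S)" for W
  proof -
    let ?G = "with_proj T \<restriction> W"
    obtain f where f: "pre_digraph.digraph_isomorphism ?G f" and S: "with_proj S = app_iso f ?G"
      using iso unfolding digraph_iso_def by blast
    have verts: "pverts S = iso_verts f ` W"
      using arg_cong[OF S, of verts] by simp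
    have arcs: "parcs S = iso_arcs f ` {e \<in> parcs T. fst e \<in> W \<and> snd e \<in> W}"
      using arg_cong[OF S, of arcs] by simp
    have ends: "iso_tail f = fst" "iso_head f = snd"
      using arg_cong[OF S, of tail] arg_cong[OF S, of head] by simp_all
    have inj: "inj_on (iso_verts f) W"
      and arc: "\<And>e. e \<in> parcs T \<Longrightarrow> fst e \<in> W \<Longrightarrow> snd e \<in> W \<Longrightarrow>
        iso_verts f (fst e) = fst (iso_arcs f e) \<and> iso_verts f (snd e) = snd (iso_arcs f e)"
      using f ends unfolding pre_digraph.digraph_isomorphism_def by auto
    \<comment> \<open>The isomorphism runs from the subtournament of \<open>T\<close> to
      \<open>S\<close>, hence the inverse.\<close>
    let ?g = "the_inv_into W (iso_verts f)"
    have "?g ` pverts S \<subseteq> pverts T"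
      using inj W verts by (auto simp: the_inv_into_f_f)
    moreover have "(?g i, ?g j) \<in> parcs T" if ij: "(i, j) \<in> parcs S" for i j
    proof -
      obtain e where e: "e \<in> parcs T" "fst e \<in> W" "snd e \<in> W" "(i, j) = iso_arcs f e"
        using ij arcs by auto
      then have "i = iso_verts f (fst e)" "j = iso_verts f (snd e)"
        using arc[of e] by (metis fst_conv, metis snd_conv)
      then show ?thesis
        using e inj by (simp add: the_inv_into_f_f)
    qed
    ultimately show ?thesis
      by blast
  qed
  have iso: "\<exists>W\<subseteq>pverts T. digraph_iso (with_proj T \<restriction> W) (with_proj S)"
    if g: "g ` pverts S \<subseteq> pverts T" "\<And>i j. (i, j) \<in> parcs S \<Longrightarrow> (g i, g j) \<in> parcs T" for g
  proof -
    let ?W = "g ` pverts S"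
    have irrefl: "(u, u) \<notin> parcs T" for u
      using T.no_loops[of "(u, u)"] by auto
    have inj: "inj_on g (pverts S)"
    proof (rule inj_onI, rule ccontr)
      fix i j assume "i \<in> pverts S" "j \<in> pverts S" "g i = g j" "i \<noteq> j"
      then show False
        using S.exactly_one_arc[of i j] g(2)[of i j] g(2)[of j i] irrefl by auto
    qed
    have arc_iff: "(g i, g j) \<in> parcs T \<longleftrightarrow> (i, j) \<in> parcs S" if "i \<in> pverts S" "j \<in> pverts S" for i j
    proof
      assume ij: "(g i, g j) \<in> parcs T"
      then have "i \<noteq> j" "g i \<noteq> g j"
        using irrefl by auto
      moreover have "g i \<in> pverts T" "g j \<in> pverts T"
        using that g(1) by auto
      ultimately show "(i, j) \<in> parcs S"
        using ij S.exactly_one_arc[OF that] T.exactly_one_arc[of "g i" "g j"] g(2)[of j i] by blast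
    qed (rule g(2))
    let ?k = "the_inv_into (pverts S) g"
    let ?f = "\<lparr>iso_verts = ?k, iso_arcs = map_prod ?k ?k, iso_head = snd, iso_tail = fst\<rparr>"
    have k: "?k (g i) = i" if "i \<in> pverts S" for i
      using that inj by (simp add: the_inv_into_f_f)
    have k_inj: "inj_on ?k ?W"
      using inj by (rule inj_on_the_inv_into)
    have "pre_digraph.digraph_isomorphism (with_proj T \<restriction> ?W) ?f"
      unfolding pre_digraph.digraph_isomorphism_def
    proof (intro conjI)
      show "wf_digraph (with_proj T \<restriction> ?W)"
        by (rule T.wellformed_induce_subgraph)
      show "inj_on (iso_arcs ?f) (arcs (with_proj T \<restriction> ?W))"
        by (auto intro!: inj_onI simp: k)
    qed (use k_inj in auto)
    moreover have "with_proj S = app_iso ?f (with_proj T \<restriction> ?W)"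
    proof (rule pre_digraph.equality)
      show "verts (with_proj S) = verts (app_iso ?f (with_proj T \<restriction> ?W))"
        using k by (auto simp: image_image)
      have "(i, j) \<in> parcs S \<longleftrightarrow> (i, j) \<in> map_prod ?k ?k ` {e \<in> parcs T. fst e \<in> ?W \<and> snd e \<in> ?W}" for i j
      proof
        assume ij: "(i, j) \<in> parcs S"
        then have V: "i \<in> pverts S" "j \<in> pverts S"
          using S.wellformed[of "(i, j)"] by auto
        then have "(i, j) = map_prod ?k ?k (g i, g j)"
          by (simp add: k)
        then show "(i, j) \<in> map_prod ?k ?k ` {e \<in> parcs T. fst e \<in> ?W \<and> snd e \<in> ?W}"
          by (rule image_eqI) (use V ij g(2) in auto)
      next
        assume "(i, j) \<in> map_prod ?k ?k ` {e \<in> parcs T. fst e \<in> ?W \<and> snd e \<in> ?W}"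
        then show "(i, j) \<in> parcs S"
          using arc_iff by (auto simp: k)
      qed
      then show "arcs (with_proj S) = arcs (app_iso ?f (with_proj T \<restriction> ?W))"
        by (auto simp del: image_Collect)
    qed simp_all
    ultimately show ?thesis
      using g(1) unfolding digraph_iso_def by blast
  qed
  have "(\<exists>W\<subseteq>pverts T. digraph_iso (with_proj T \<restriction> W) (with_proj S)) \<longleftrightarrow>
      (\<exists>g. g ` pverts S \<subseteq> pverts T \<and> (\<forall>i j. (i, j) \<in> parcs S \<longrightarrow> (g i, g j) \<in> parcs T))"
    by (rule iffI; elim exE conjE) (erule (1) embed, rule iso, assumption, blast)
  then show ?thesis
    unfolding tournament_free_def by (rule arg_cong)
qed

context tournament
begin

lemma arc_verts: "(u, v) \<in> parcs T \<Longrightarrow> u \<in> pverts T \<and> v \<in> pverts T"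
  using wellformed[of "(u, v)"] by simp

lemma rel_tournament_arcs: "rel_tournament (pverts T) (\<lambda>u v. (u, v) \<in> parcs T)"
proof
  show "finite (pverts T)"
    using finite_verts by simp
  show "(v, u) \<notin> parcs T" if "(u, v) \<in> parcs T" for u v
    using that exactly_one_arc[of u v] arc_verts[OF that] no_loops[of "(u, v)"] by auto
  show "(u, v) \<in> parcs T \<or> (v, u) \<in> parcs T" if "u \<in> pverts T" "v \<in> pverts T" "u \<noteq> v" for u v
    using exactly_one_arc[OF that] by blast
qed

lemma delta_free_arcs:
  assumes "tournament_free Delta122 T"
  shows "delta_free (\<lambda>u v. (u, v) \<in> parcs T)"
  unfolding delta_free_def
proof (intro allI notI)
  fix x y y' z z' :: 'a
  let ?g = "\<lambda>i. [x, y, y', z, z'] ! i"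
  assume *: "(x, y) \<in> parcs T \<and> (x, y') \<in> parcs T \<and> (y, y') \<in> parcs T \<and> (y, z) \<in> parcs T \<and>
    (y, z') \<in> parcs T \<and> (y', z) \<in> parcs T \<and> (y', z') \<in> parcs T \<and> (z, z') \<in> parcs T \<and>
    (z, x) \<in> parcs T \<and> (z', x) \<in> parcs T"
  then have "?g ` pverts Delta122 \<subseteq> pverts T"
    using arc_verts unfolding Delta122_def by auto
  moreover have "\<forall>i j. (i, j) \<in> parcs Delta122 \<longrightarrow> (?g i, ?g j) \<in> parcs T"
    using * unfolding Delta122_def by auto
  ultimately show False
    using assms tournament_free_iff[OF tournament_Delta122 tournament_axioms] by blast
qed

lemma P7_free_iff:
  "tournament_free P7 T \<longleftrightarrow> \<not> (\<exists>h. P7_embedding (\<lambda>u v. (u, v) \<in> parcs T) h)"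
proof -
  have "\<exists>h. P7_embedding (\<lambda>u v. (u, v) \<in> parcs T) h"
    if g: "\<And>i j. (i, j) \<in> parcs P7 \<Longrightarrow> (g i, g j) \<in> parcs T" for g
  proof -
    \<comment> \<open>Representatives in 1 to 7 rather than 0 to 6, matching the vertices of
      \<open>P7\<close>.\<close>
    let ?r = "\<lambda>i::int. (i - 1) mod 7 + 1"
    define h where "h i = g (?r i)" for i
    have "(h i, h (i + d)) \<in> parcs T" if "d \<in> {1, 2, 4}" for i d
      unfolding h_def
    proof (rule g)
      have "(?r (i + d) - ?r i) mod 7 = d mod 7"
        by (simp add: mod_simps)
      moreover have "?r i \<in> {1..7}" for i
        using pos_mod_bound[of 7 "i - 1"] pos_mod_sign[of 7 "i - 1"] by auto
      ultimately show "(?r i, ?r (i + d)) \<in> parcs P7"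
        using that unfolding P7_def by auto
    qed
    moreover have "h (i + 7) = h i" for i
      unfolding h_def by (metis add_diff_eq diff_add_eq mod_add_self2)
    ultimately have "P7_embedding (\<lambda>u v. (u, v) \<in> parcs T) h"
      unfolding P7_embedding_def by simp
    then show ?thesis
      by blast
  qed
  moreover have "h ` pverts P7 \<subseteq> pverts T \<and> (\<forall>i j. (i, j) \<in> parcs P7 \<longrightarrow> (h i, h j) \<in> parcs T)"
    if h: "P7_embedding (\<lambda>u v. (u, v) \<in> parcs T) h" for h
  proof -
    have "h i \<in> pverts T" for i
      using arc_verts[OF P7_embedding_arc[OF h, of "i + 1" i]] by simp
    moreover have "(h i, h j) \<in> parcs T" if "(i, j) \<in> parcs P7" for i j
      by (rule P7_embedding_arc[OF h]) (use that in \<open>simp add: P7_def\<close>)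
    ultimately show ?thesis
      by blast
  qed
  ultimately show ?thesis
    unfolding tournament_free_iff[OF tournament_P7 tournament_axioms] by blast
qed

text \<open>A failure of transitivity within a class is, by totality, a cyclic triangle.\<close>

lemma colouring_iff:
  "colouring T k f \<longleftrightarrow> f ` pverts T \<subseteq> {1..k} \<and> proper (pverts T) (\<lambda>u v. (u, v) \<in> parcs T) f"
proof -
  interpret R: rel_tournament "pverts T" "\<lambda>u v. (u, v) \<in> parcs T"
    by (rule rel_tournament_arcs)
  let ?C = "\<lambda>i. {v \<in> pverts T. f v = i}"
  have ends: "(u, v) \<in> arcs_ends (with_proj T \<restriction> ?C i) \<longleftrightarrow>
      (u, v) \<in> parcs T \<and> u \<in> ?C i \<and> v \<in> ?C i" for u v i
    by (simp add: arcs_ends_conv)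
  have trans: "trans (arcs_ends (with_proj T \<restriction> ?C i)) \<longleftrightarrow>
      (\<forall>x\<in>?C i. \<forall>y\<in>?C i. \<forall>z\<in>?C i. \<not> ((x, y) \<in> parcs T \<and> (y, z) \<in> parcs T \<and> (z, x) \<in> parcs T))"
    (is "?L \<longleftrightarrow> ?R") for i
  proof
    assume L: ?L
    show ?R
    proof (intro ballI notI; elim conjE)
      fix x y z
      assume *: "x \<in> ?C i" "y \<in> ?C i" "z \<in> ?C i" "(x, y) \<in> parcs T" "(y, z) \<in> parcs T" "(z, x) \<in> parcs T"
      have "(x, z) \<in> arcs_ends (with_proj T \<restriction> ?C i)"
        by (rule transD[OF L, of x y z]) (simp_all only: ends * simp_thms)
      then have "(x, z) \<in> parcs T"
        unfolding ends by (rule conjunct1)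
      with R.asym[OF *(6)] show False
        by (rule notE)
    qed
  next
    assume R: ?R
    show ?L
    proof (rule transI)
      fix x y z
      assume "(x, y) \<in> arcs_ends (with_proj T \<restriction> ?C i)" "(y, z) \<in> arcs_ends (with_proj T \<restriction> ?C i)"
      then have *: "(x, y) \<in> parcs T" "(y, z) \<in> parcs T" "x \<in> ?C i" "y \<in> ?C i" "z \<in> ?C i"
        unfolding ends by simp_all
      then have "(z, x) \<notin> parcs T"
        using R by blast
      moreover have "x \<noteq> z"
        using R.asym[OF *(1)] *(2) by blast
      ultimately have "(x, z) \<in> parcs T"
        using R.total[of x z] *(3,5) by simp
      then show "(x, z) \<in> arcs_ends (with_proj T \<restriction> ?C i)"
        unfolding ends using *(3,5) by simp
    qed
  qed
  have "(\<forall>i\<in>{1..k}. trans (arcs_ends (with_proj T \<restriction> ?C i))) \<longleftrightarrow>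
      proper (pverts T) (\<lambda>u v. (u, v) \<in> parcs T) f" if range: "f ` pverts T \<subseteq> {1..k}"
    unfolding trans proper_def
  proof (rule iffI; intro ballI impI notI; elim conjE)
    fix x y z
    assume L: "\<forall>i\<in>{1..k}. \<forall>x\<in>?C i. \<forall>y\<in>?C i. \<forall>z\<in>?C i.
        \<not> ((x, y) \<in> parcs T \<and> (y, z) \<in> parcs T \<and> (z, x) \<in> parcs T)"
      and *: "x \<in> pverts T" "y \<in> pverts T" "z \<in> pverts T" "(x, y) \<in> parcs T" "(y, z) \<in> parcs T"
        "(z, x) \<in> parcs T" "f x = f y" "f y = f z"
    have "f x \<in> {1..k}" "x \<in> ?C (f x)" "y \<in> ?C (f x)" "z \<in> ?C (f x)"
      using range * by auto
    from L[THEN bspec, THEN bspec, THEN bspec, THEN bspec, OF this] *(4-6) show False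
      by argo
  next
    fix i x y z
    assume R: "\<forall>x\<in>pverts T. \<forall>y\<in>pverts T. \<forall>z\<in>pverts T. (x, y) \<in> parcs T \<and> (y, z) \<in> parcs T \<and>
        (z, x) \<in> parcs T \<longrightarrow> \<not> (f x = f y \<and> f y = f z)"
      and *: "x \<in> ?C i" "y \<in> ?C i" "z \<in> ?C i" "(x, y) \<in> parcs T" "(y, z) \<in> parcs T" "(z, x) \<in> parcs T"
    then have "x \<in> pverts T" "y \<in> pverts T" "z \<in> pverts T" and f: "f x = f y" "f y = f z"
      by simp_all
    from R[THEN bspec, THEN bspec, THEN bspec, OF this(1-3)] f *(4-6) show False
      by argo
  qed
  then show ?thesis
    unfolding colouring_def by (rule conj_cong[OF refl])
qed

end

theorem theorem1p3:
  fixes T :: "'a pair_pre_digraph"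
  assumes "tournament T"
    and "tournament_free Delta122 T"
  shows "colourable 3 T \<and> (colourable 2 T \<longleftrightarrow> tournament_free P7 T)"
proof -
  interpret tournament T by fact
  let ?E = "\<lambda>u v. (u, v) \<in> parcs T"
  note T = rel_tournament_arcs
  note df = delta_free_arcs[OF assms(2)]
  have "\<exists>f :: 'a \<Rightarrow> nat. f ` pverts T \<subseteq> {1..3} \<and> proper (pverts T) ?E f"
    using T df arc_verts by (rule three_colouring)
  then have "colourable 3 T"
    unfolding colourable_def colouring_iff .
  moreover have "colourable 2 T" if free: "tournament_free P7 T"
  proof -
    have "\<not> (\<exists>h. P7_embedding ?E h)"
      using free by (rule P7_free_iff[THEN iffD1])
    then have "\<exists>f :: 'a \<Rightarrow> bool. proper (pverts T) ?E f"
      using two_colouring_or_P7[OF T df] by argo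
    then obtain f :: "'a \<Rightarrow> bool" where f: "proper (pverts T) ?E f"
      by (rule exE)
    let ?c = "\<lambda>v. if f v then 1 else 2 :: nat"
    have "proper (pverts T) ?E ?c"
      using f by (rule proper_recolour) (simp split: if_splits)
    then have "colouring T 2 ?c"
      unfolding colouring_iff by (intro conjI) auto
    then show ?thesis
      unfolding colourable_def by (intro exI[of _ ?c])
  qed
  moreover have "tournament_free P7 T" if col: "colourable 2 T"
  proof -
    obtain f where "colouring T 2 f"
      using col unfolding colourable_def by (rule exE)
    then have f: "f ` pverts T \<subseteq> {1..2}" "proper (pverts T) ?E f"
      unfolding colouring_iff by simp_all
    \<comment> \<open>With only the colours 1 and 2, \<open>f\<close> is determined by the predicate
      \<open>f v = 1\<close>.\<close>
    have "f u = f v" if "u \<in> pverts T" "v \<in> pverts T" "(f u = 1) = (f v = 1)" for u v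
    proof -
      have "f u \<in> {1..2}" "f v \<in> {1..2}"
        using f(1) that(1,2) by blast+
      with that(3) show ?thesis
        by (cases "f u = 1") auto
    qed
    with f(2) have "proper (pverts T) ?E (\<lambda>v. f v = 1)"
      by (rule proper_recolour)
    moreover have "range h \<subseteq> pverts T" if h: "P7_embedding ?E h" for h
    proof -
      have "h i \<in> pverts T" for i
        using arc_verts[OF P7_embedding_arc[OF h, of "i + 1" i]] by simp
      then show ?thesis
        by blast
    qed
    ultimately have "\<not> (\<exists>h. P7_embedding ?E h)"
      using P7_not_two_colourable by metis
    then show ?thesis
      by (rule P7_free_iff[THEN iffD2])
  qed
  ultimately show ?thesis
    by argo
qed

end
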